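(* Let $\langle X,\mathcal{M},\mathbf{O}\rangle$ be a measurement scenario with $X$ finite and with each outcome space $\mathbf{O}_x$ ($x\in X$) the Borel measurable space of a compact Hausdorff space $O_x$. Let $e=(e_C)_{C\in\mathcal{M}}$ be an empirical model on it. Then: (i) the normalised violation by $e$ of any generalised Bell inequality is at most $\mathsf{CF}(e)$; (ii) if $\mathsf{CF}(e)>0$ then for every $\varepsilon>0$ there exists a generalised Bell inequality whose normalised violation by $e$ is at least $\mathsf{CF}(e)-\varepsilon$.
   Context: A measurement scenario $\langle X,\mathcal{M},\mathbf{O}\rangle$ consists of: a set $X$ of measurement labels; a family $\mathcal{M}$ of subsets of $X$ with $\bigcup\mathcal{M}=X$ that is an anti-chain for inclusion (its elements are called maximal contexts); and, for each $x\in X$, a measurable space $\mathbf{O}_x=\langle O_x,\mathcal{F}_x\rangle$. For $U\subseteq X$, $\mathbf{O}_U=\prod_{x\in U}\mathbf{O}_x$ is the product measurable space, with underlying set $O_U=\prod_{x\in U}O_x$ (given the product topology). For $U\subseteq V$ and a measure $\mu$ on $\mathbf{O}_V$, $\mu|_U$ denotes the marginal, i.e. the push-forward along the projection $O_V\to O_U$. An empirical model $e$ on the scenario is a family $(e_C)_{C\in\mathcal{M}}$ with $e_C$ a probability measure on $\mathbf{O}_C$, such that $e_C|_{C\cap C'}=e_{C'}|_{C\cap C'}$ for all $C,C'\in\mathcal{M}$. It is noncontextual if there is a probability measure $\mu$ on $\mathbf{O}_X$ with $\mu|_C=e_C$ for all $C\in\mathcal{M}$. The noncontextual fraction is $\mathsf{NCF}(e)=\sup\{\mu(O_X):\mu\text{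 a (nonnegative) measure on }\mathbf{O}_X,\ \mu|_C\le e_C\ \text{for all } C\in\mathcal{M}\}$ (setwise inequality), and the contextual fraction is $\mathsf{CF}(e)=1-\mathsf{NCF}(e)$. A form on the scenario is a family $\beta=(\beta_C)_{C\in\mathcal{M}}$ of continuous functions $\beta_C\in C(O_C,\mathbb{R})$. Its value on $e$ is $\langle\beta,e\rangle_2=\sum_{C\in\mathcal{M}}\int_{O_C}\beta_C\,de_C$, and its norm is $\|\beta\|=\sum_{C\in\mathcal{M}}\sup\{\beta_C(\mathbf{o}):\mathbf{o}\in O_C\}$. An inequality is a pair $(\beta,R)$ of a form $\beta$ and a bound $R\in\mathbb{R}$; only inequalities with $R<\|\beta\|$ are considered. It is a generalised Bell inequality if $\langle\beta,d\rangle_2\le R$ for every noncontextual empirical model $d$ on the scenario. The normalised violation of a generalised Bell inequality $(\beta,R)$ by $e$ is $$\frac{\max\{0,\langle\beta,e\rangle_2-R\}}{\|\beta\|-R}.$$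
   Formalization: In (ii) each e_C is additionally assumed regular (inner approximable by measurable compact sets), automatic for metrizable O_x; without it (ii) fails, e.g. for models built from the Dieudonné measure and the point mass at ω₁ on ω₁+1. Part (i) needs no such assumption. *)

theory Defs
  imports "HOL-Probability.Probability"
begin

text \<open>
  Label sets are sets \<open>U :: 'x set\<close>. Outcome spaces are given as a family \<open>\<Omega> :: 'x \<Rightarrow> 'o measure\<close>
  of which only \<open>space (\<Omega> x)\<close> and \<open>sets (\<Omega> x)\<close> are used, so that the product measurable space over
  \<open>U\<close> is \<open>Pi\<^sub>M U \<Omega>\<close>, with underlying set \<open>\<Pi>\<^sub>E x\<in>U. space (\<Omega> x)\<close>. All \<open>O\<^sub>x\<close> being subsets of one
  type \<open>'o\<close> is no restriction, since \<open>'o\<close> can be taken to contain their disjoint union.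
  Families indexed by contexts are total functions whose values outside \<open>\<M>\<close> play no role.
\<close>

definition measurement_scenario :: "'x set \<Rightarrow> 'x set set \<Rightarrow> bool" where
  "measurement_scenario X \<M> \<longleftrightarrow> \<Union>\<M> = X \<and> (\<forall>C\<in>\<M>. \<forall>C'\<in>\<M>. C \<subseteq> C' \<longrightarrow> C = C')"

definition marginal ::
  "('x \<Rightarrow> 'o measure) \<Rightarrow> 'x set \<Rightarrow> ('x \<Rightarrow> 'o) measure \<Rightarrow> ('x \<Rightarrow> 'o) measure" where
  "marginal \<Omega> U \<mu> = distr \<mu> (Pi\<^sub>M U \<Omega>) (\<lambda>\<omega>. restrict \<omega> U)"

definition empirical_model ::
  "'x set set \<Rightarrow> ('x \<Rightarrow> 'o measure) \<Rightarrow> ('x set \<Rightarrow> ('x \<Rightarrow> 'o) measure) \<Rightarrow> bool" where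
  "empirical_model \<M> \<Omega> e \<longleftrightarrow>
     (\<forall>C\<in>\<M>. prob_space (e C) \<and> sets (e C) = sets (Pi\<^sub>M C \<Omega>)) \<and>
     (\<forall>C\<in>\<M>. \<forall>C'\<in>\<M>. marginal \<Omega> (C \<inter> C') (e C) = marginal \<Omega> (C \<inter> C') (e C'))"

definition noncontextual ::
  "'x set \<Rightarrow> 'x set set \<Rightarrow> ('x \<Rightarrow> 'o measure) \<Rightarrow> ('x set \<Rightarrow> ('x \<Rightarrow> 'o) measure) \<Rightarrow> bool" where
  "noncontextual X \<M> \<Omega> e \<longleftrightarrow>
     (\<exists>\<mu>. prob_space \<mu> \<and> sets \<mu> = sets (Pi\<^sub>M X \<Omega>) \<and> (\<forall>C\<in>\<M>. marginal \<Omega> C \<mu> = e C))"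

text \<open>
  The inequality of measures is stated setwise because \<open>\<le>\<close> on type \<open>measure\<close> is
  a lexicographic order that also compares spaces and \<open>\<sigma>\<close>-algebras.
\<close>

definition dominated_measures ::
  "'x set \<Rightarrow> 'x set set \<Rightarrow> ('x \<Rightarrow> 'o measure) \<Rightarrow> ('x set \<Rightarrow> ('x \<Rightarrow> 'o) measure)
     \<Rightarrow> ('x \<Rightarrow> 'o) measure set" where
  "dominated_measures X \<M> \<Omega> e =
     {\<mu>. sets \<mu> = sets (Pi\<^sub>M X \<Omega>) \<and>
         (\<forall>C\<in>\<M>. \<forall>A\<in>sets (Pi\<^sub>M C \<Omega>). emeasure (marginal \<Omega> C \<mu>) A \<le> emeasure (e C) A)}"

definition noncontextual_fraction ::
  "'x set \<Rightarrow> 'x set set \<Rightarrow> ('x \<Rightarrow> 'o measure) \<Rightarrow> ('x set \<Rightarrow> ('x \<Rightarrow> 'o) measure) \<Rightarrow> ennreal" where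
  "noncontextual_fraction X \<M> \<Omega> e =
     (SUP \<mu>\<in>dominated_measures X \<M> \<Omega> e. emeasure \<mu> (space \<mu>))"

text \<open>
  The contextual fraction is extended-real valued only because of the degenerate scenario
  \<open>X = \<M> = {}\<close>, where the supremum above is over an unconstrained set and equals \<open>\<infinity>\<close>.
  As soon as \<open>\<M> \<noteq> {}\<close>, both fractions of an empirical model lie in \<open>[0, 1]\<close>.
\<close>

definition contextual_fraction ::
  "'x set \<Rightarrow> 'x set set \<Rightarrow> ('x \<Rightarrow> 'o measure) \<Rightarrow> ('x set \<Rightarrow> ('x \<Rightarrow> 'o) measure) \<Rightarrow> ereal" where
  "contextual_fraction X \<M> \<Omega> e = 1 - enn2ereal (noncontextual_fraction X \<M> \<Omega> e)"

definition borel_space :: "'a topology \<Rightarrow> 'a measure" where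
  "borel_space T = sigma (topspace T) {U. openin T U}"

definition form :: "('x \<Rightarrow> 'o topology) \<Rightarrow> 'x set set \<Rightarrow> ('x set \<Rightarrow> ('x \<Rightarrow> 'o) \<Rightarrow> real) \<Rightarrow> bool" where
  "form T \<M> \<beta> \<longleftrightarrow> (\<forall>C\<in>\<M>. continuous_map (product_topology T C) euclideanreal (\<beta> C))"

definition form_value ::
  "'x set set \<Rightarrow> ('x set \<Rightarrow> ('x \<Rightarrow> 'o) \<Rightarrow> real) \<Rightarrow> ('x set \<Rightarrow> ('x \<Rightarrow> 'o) measure) \<Rightarrow> real" where
  "form_value \<M> \<beta> e = (\<Sum>C\<in>\<M>. \<integral>\<omega>. \<beta> C \<omega> \<partial>e C)"

definition form_norm ::
  "('x \<Rightarrow> 'o topology) \<Rightarrow> 'x set set \<Rightarrow> ('x set \<Rightarrow> ('x \<Rightarrow> 'o) \<Rightarrow> real) \<Rightarrow> real" where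
  "form_norm T \<M> \<beta> = (\<Sum>C\<in>\<M>. SUP \<omega>\<in>topspace (product_topology T C). \<beta> C \<omega>)"

definition generalised_bell_inequality ::
  "'x set \<Rightarrow> 'x set set \<Rightarrow> ('x \<Rightarrow> 'o topology) \<Rightarrow> ('x set \<Rightarrow> ('x \<Rightarrow> 'o) \<Rightarrow> real) \<Rightarrow> real \<Rightarrow> bool" where
  "generalised_bell_inequality X \<M> T \<beta> R \<longleftrightarrow>
     form T \<M> \<beta> \<and> R < form_norm T \<M> \<beta> \<and>
     (\<forall>d. empirical_model \<M> (\<lambda>x. borel_space (T x)) d \<and>
          noncontextual X \<M> (\<lambda>x. borel_space (T x)) d \<longrightarrow> form_value \<M> \<beta> d \<le> R)"

definition normalised_violation ::
  "('x \<Rightarrow> 'o topology) \<Rightarrow> 'x set set \<Rightarrow> ('x set \<Rightarrow> ('x \<Rightarrow> 'o) \<Rightarrow> real) \<Rightarrow> real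
     \<Rightarrow> ('x set \<Rightarrow> ('x \<Rightarrow> 'o) measure) \<Rightarrow> real" where
  "normalised_violation T \<M> \<beta> R e =
     (max 0 (form_value \<M> \<beta> e - R)) / (form_norm T \<M> \<beta> - R)"

text \<open>
  Regularity (the Radon property) of a measure with respect to a topology on its space. The
  approximating compact sets are required to be measurable, because the product of the Borel
  \<open>\<sigma>\<close>-algebras of non-second-countable spaces can be smaller than the Borel \<open>\<sigma>\<close>-algebra of the
  product topology. On a finite product of Borel spaces of compact metrizable spaces,
  every finite measure is regular.
  Without regularity a measure on a compact Hausdorff space is not determined by the integrals of
  continuous functions: on \<open>\<omega>\<^sub>1 + 1\<close> the Dieudonne measure and the point mass at \<open>\<omega>\<^sub>1\<close> have
  the same ones.
\<close>

definition regular_measure :: "'a topology \<Rightarrow> 'a measure \<Rightarrow> bool" where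
  "regular_measure T \<mu> \<longleftrightarrow>
     (\<forall>A\<in>sets \<mu>. emeasure \<mu> A = (SUP K\<in>{K\<in>sets \<mu>. K \<subseteq> A \<and> compactin T K}. emeasure \<mu> K))"

end

theory Submission
  imports Defs
begin

text \<open>
  A measure dominated by \<open>e\<close> of mass \<open>w\<close>, once normalised, yields a noncontextual model, so the
  value of a Bell inequality on \<open>e\<close> is at most \<open>w R + (1 - w) \<parallel>\<beta>\<parallel>\<close>; this is (i).

  For (ii), let \<open>p f\<close> be the least total \<open>e\<close>-integral of families of lower semicontinuous
  \<open>b\<^sub>C \<ge> 0\<close> with \<open>\<Sum>\<^sub>C b\<^sub>C (\<omega>|\<^sub>C) \<ge> f \<omega>\<close>. By Hahn-Banach there is an additive \<open>l \<le> p\<close> on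
  bounded functions with \<open>l 1 = p 1\<close>, and \<open>A \<mapsto> l 1\<^sub>A\<close> is a finitely additive content on all
  subsets of \<open>O\<^sub>X\<close> whose marginals are dominated by \<open>e\<close> on open sets, hence by regularity on all
  measurable sets. Regularity of the \<open>e\<^sub>C\<close> also makes the content regular on cylinders, so by
  compactness it extends to a measure dominated by \<open>e\<close>, of mass \<open>p 1\<close>. Thus \<open>p 1 \<le> NCF\<close>, and a
  nearly optimal cover of \<open>1\<close>, made continuous (\<open>h\<^sub>C\<close>) by compactness, gives the Bell inequality
  \<open>\<beta>\<^sub>C = const - h\<^sub>C\<close> with \<open>R = 0\<close>.
\<close>

section \<open>Hahn-Banach for sublinear functionals\<close>

definition fun_subspace :: "('a \<Rightarrow> real) set \<Rightarrow> bool" where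
  "fun_subspace V \<longleftrightarrow> (\<forall>f\<in>V. \<forall>g\<in>V. (\<lambda>x. f x + g x) \<in> V) \<and> (\<forall>f\<in>V. \<forall>c. (\<lambda>x. c * f x) \<in> V)"

text \<open>Homogeneity is stated as an inequality because infima deliver it in that form; equality
  is recovered in \<open>sublinear_on_scale\<close>.\<close>

definition sublinear_on :: "('a \<Rightarrow> real) set \<Rightarrow> (('a \<Rightarrow> real) \<Rightarrow> real) \<Rightarrow> bool" where
  "sublinear_on V q \<longleftrightarrow>
     (\<forall>f\<in>V. \<forall>g\<in>V. q (\<lambda>x. f x + g x) \<le> q f + q g) \<and> (\<forall>f\<in>V. \<forall>c\<ge>0. q (\<lambda>x. c * f x) \<le> c * q f)"

lemma fun_subspaceD:
  assumes "fun_subspace V" "f \<in> V"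
  shows "g \<in> V \<Longrightarrow> (\<lambda>x. f x + g x) \<in> V" "(\<lambda>x. c * f x) \<in> V" "(\<lambda>x. - f x) \<in> V"
proof -
  show *: "(\<lambda>x. c * f x) \<in> V" for c using assms unfolding fun_subspace_def by blast
  show "g \<in> V \<Longrightarrow> (\<lambda>x. f x + g x) \<in> V" using assms unfolding fun_subspace_def by blast
  show "(\<lambda>x. - f x) \<in> V" using *[of "-1"] by simp
qed

lemma sublinear_onD:
  assumes "sublinear_on V q" "f \<in> V"
  shows "g \<in> V \<Longrightarrow> q (\<lambda>x. f x + g x) \<le> q f + q g" "c \<ge> 0 \<Longrightarrow> q (\<lambda>x. c * f x) \<le> c * q f"
  using assms unfolding sublinear_on_def by blast+

text \<open>For \<open>c > 0\<close>, scaling back by \<open>inverse c\<close> gives the converse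
  inequality. For \<open>c = 0\<close>, subadditivity at the zero function shows that its value
  cannot be negative.\<close>

lemma sublinear_on_scale:
  assumes V: "fun_subspace V" and q: "sublinear_on V q" and f: "f \<in> V" and c: "c \<ge> 0"
  shows "q (\<lambda>x. c * f x) = c * q f"
proof (cases "c = 0")
  case True
  have z: "(\<lambda>x. 0) \<in> V" using fun_subspaceD(2)[OF V f, of 0] by simp
  have "q (\<lambda>x. 0) \<le> 0" using sublinear_onD(2)[OF q f, of 0] by simp
  moreover have "q (\<lambda>x. 0) \<ge> 0" using sublinear_onD(1)[OF q z z] by simp
  ultimately show ?thesis using True by simp
next
  case False
  then have "q (\<lambda>x. inverse c * (c * f x)) \<le> inverse c * q (\<lambda>x. c * f x)"
    using c by (intro sublinear_onD(2)[OF q] fun_subspaceD(2)[OF V f]) simp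
  then have "c * q f \<le> q (\<lambda>x. c * f x)"
    using False c by (simp add: mult.assoc[symmetric] field_simps)
  then show ?thesis using sublinear_onD(2)[OF q f c] by simp
qed

lemma sublinear_on_minus:
  assumes V: "fun_subspace V" and q: "sublinear_on V q" and f: "f \<in> V"
  shows "- q (\<lambda>x. - f x) \<le> q f"
proof -
  have "q (\<lambda>x. f x + - f x) \<le> q f + q (\<lambda>x. - f x)"
    by (rule sublinear_onD(1)[OF q f fun_subspaceD(3)[OF V f]])
  moreover have "q (\<lambda>x. 0) = 0" using sublinear_on_scale[OF V q f, of 0] by simp
  ultimately show ?thesis by simp
qed

text \<open>The functional is the infimum over \<open>t \<ge> 0\<close> of
  \<open>q (f + t u) - t q u\<close>; the choices \<open>t = 0\<close> and \<open>t = 1\<close> give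
  the two bounds. The second pushes the value at \<open>- u\<close> down to \<open>- q u\<close>, so
  that an additive functional below \<open>q'\<close> must take the value \<open>q u\<close> at
  \<open>u\<close>.\<close>

lemma sublinear_on_tilt:
  assumes V: "fun_subspace V" and q: "sublinear_on V q" and u: "u \<in> V"
  obtains q' where "sublinear_on V q'" "\<And>f. f \<in> V \<Longrightarrow> q' f \<le> q f"
    "\<And>f. f \<in> V \<Longrightarrow> q' f \<le> q (\<lambda>x. f x + u x) - q u"
proof -
  define r where "r f t = q (\<lambda>x. f x + t * u x) - t * q u" for f t
  define q' where "q' f = (INF t\<in>{0..}. r f t)" for f
  have shift: "(\<lambda>x. f x + t * u x) \<in> V" if "f \<in> V" for f t
    by (rule fun_subspaceD(1)[OF V that fun_subspaceD(2)[OF V u]])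
  have bdd: "bdd_below (r f ` {0..})" if f: "f \<in> V" for f
  proof (rule bdd_belowI2[of _ "- q (\<lambda>x. - f x)"])
    fix t :: real assume t: "t \<in> {0..}"
    \<comment> \<open>The function \<open>t u\<close> is split as \<open>(f + t u) - f\<close> and
      has value \<open>t * q u\<close>, so the resulting lower bound is free of
      \<open>t\<close>.\<close>
    have "q (\<lambda>x. (f x + t * u x) + - f x) \<le> q (\<lambda>x. f x + t * u x) + q (\<lambda>x. - f x)"
      by (rule sublinear_onD(1)[OF q shift[OF f] fun_subspaceD(3)[OF V f]])
    then show "- q (\<lambda>x. - f x) \<le> r f t"
      using sublinear_on_scale[OF V q u, of t] t by (simp add: r_def)
  qed
  have le: "q' f \<le> r f t" if "f \<in> V" "t \<ge> 0" for f t
    unfolding q'_def using that by (intro cINF_lower bdd) auto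
  have ge: "a \<le> q' f" if "\<And>t. t \<ge> 0 \<Longrightarrow> a \<le> r f t" for a f
    unfolding q'_def using that by (intro cINF_greatest) auto
  show ?thesis
  proof
    show "sublinear_on V q'"
      unfolding sublinear_on_def
    proof (intro conjI ballI allI impI)
      fix f g assume f: "f \<in> V" and g: "g \<in> V"
      \<comment> \<open>Independent parameters for the two summands are merged into
        \<open>s + t\<close>, so that the two infima can afterwards be taken one at a time.\<close>
      have *: "q' (\<lambda>x. f x + g x) \<le> r f s + r g t" if "s \<ge> 0" "t \<ge> 0" for s t
      proof -
        have "q' (\<lambda>x. f x + g x) \<le> r (\<lambda>x. f x + g x) (s + t)"
          using that by (intro le fun_subspaceD(1)[OF V f g]) auto
        also have "\<dots> = q (\<lambda>x. (f x + s * u x) + (g x + t * u x)) - (s + t) * q u"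
          unfolding r_def by (simp add: algebra_simps)
        also have "\<dots> \<le> r f s + r g t"
          using sublinear_onD(1)[OF q shift[OF f] shift[OF g], of s t]
          unfolding r_def distrib_right by linarith
        finally show ?thesis .
      qed
      have "q' (\<lambda>x. f x + g x) - r f s \<le> q' g" if "s \<ge> 0" for s
        using *[OF that] by (intro ge) (simp add: algebra_simps)
      then have "q' (\<lambda>x. f x + g x) - q' g \<le> q' f"
        by (intro ge) (simp add: algebra_simps)
      then show "q' (\<lambda>x. f x + g x) \<le> q' f + q' g" by simp
    next
      fix f :: "'a \<Rightarrow> real" and c :: real assume f: "f \<in> V" and c: "0 \<le> c"
      have *: "q' (\<lambda>x. c * f x) \<le> c * r f t" if t: "t \<ge> 0" for t
      proof -
        have "q' (\<lambda>x. c * f x) \<le> r (\<lambda>x. c * f x) (c * t)"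
          using t c by (intro le fun_subspaceD(2)[OF V f]) auto
        also have "\<dots> = q (\<lambda>x. c * (f x + t * u x)) - c * t * q u"
          unfolding r_def by (simp add: algebra_simps)
        also have "\<dots> = c * r f t"
          unfolding sublinear_on_scale[OF V q shift[OF f] c] r_def by (simp add: algebra_simps)
        finally show ?thesis .
      qed
      show "q' (\<lambda>x. c * f x) \<le> c * q' f"
      proof (cases "c = 0")
        case True
        then show ?thesis using *[of 0] by simp
      next
        case False
        then have "q' (\<lambda>x. c * f x) / c \<le> q' f"
          using c * by (intro ge) (simp add: field_simps)
        then show ?thesis using False c by (simp add: field_simps)
      qed
    qed
    show "q' f \<le> q f" if "f \<in> V" for f using le[OF that, of 0] by (simp add: r_def)
    show "q' f \<le> q (\<lambda>x. f x + u x) - q u" if "f \<in> V" for f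
      using le[OF that, of 1] by (simp add: r_def)
  qed
qed

text \<open>A minimal sublinear functional is unchanged by the tilts of \<open>sublinear_on_tilt\<close>, and this
  forces additivity.\<close>

lemma sublinear_on_minorant_additive:
  assumes V: "fun_subspace V" and p: "sublinear_on V p"
  obtains l where "\<And>f. f \<in> V \<Longrightarrow> l f \<le> p f" "\<And>f g. f \<in> V \<Longrightarrow> g \<in> V \<Longrightarrow> l (\<lambda>x. f x + g x) = l f + l g"
proof -
  \<comment> \<open>Fixing the value \<open>0\<close> off \<open>V\<close> makes the pointwise order
    and the equality of functionals depend on \<open>V\<close> only.\<close>
  define S where "S = {q. sublinear_on V q \<and> (\<forall>f\<in>V. q f \<le> p f) \<and> (\<forall>f. f \<notin> V \<longrightarrow> q f = 0)}"
  have cut: "sublinear_on V (\<lambda>f. if f \<in> V then q f else 0)" if "sublinear_on V q" for q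
    using that fun_subspaceD[OF V] by (auto simp: sublinear_on_def)
  have "\<exists>m\<in>S. \<forall>q\<in>S. q \<le> m \<longrightarrow> q = m"
  proof (rule predicate_Zorn)
    \<comment> \<open>The order is reversed, so that Zorn's lemma yields a minimal element and
      chains have to be bounded from below.\<close>
    show "partial_order_on S (relation_of (\<lambda>m q. q \<le> m) S)"
      by (rule partial_order_on_relation_ofI) auto
    fix C assume C: "C \<in> Chains (relation_of (\<lambda>m q. q \<le> m) S)"
    then have CS: "q \<in> S" if "q \<in> C" for q
      using that by (auto simp: Chains_def relation_of_def)
    then have Csub: "sublinear_on V q" and Cp: "f \<in> V \<Longrightarrow> q f \<le> p f" if "q \<in> C" for q f
      using that by (auto simp: S_def)
    have tot: "q \<le> q' \<or> q' \<le> q" if "q \<in> C" "q' \<in> C" for q q'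
      using C that by (auto simp: Chains_def relation_of_def)
    show "\<exists>u\<in>S. \<forall>a\<in>C. u \<le> a"
    proof (cases "C = {}")
      case True
      then show ?thesis using cut[OF p] by (intro bexI[of _ "\<lambda>f. if f \<in> V then p f else 0"]) (auto simp: S_def)
    next
      case False
      \<comment> \<open>The lower bound of a nonempty chain is its pointwise infimum, finite on
        \<open>V\<close> because every member is at least \<open>- p (- f)\<close> at
        \<open>f\<close>.\<close>
      define u where "u f = (INF q\<in>C. q f)" for f
      have bdd: "bdd_below ((\<lambda>q. q f) ` C)" for f
      proof (cases "f \<in> V")
        case True
        show ?thesis
        proof (rule bdd_belowI2[of _ "- p (\<lambda>x. - f x)"])
          fix q assume "q \<in> C"
          then have "sublinear_on V q" "q (\<lambda>x. - f x) \<le> p (\<lambda>x. - f x)"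
            using CS fun_subspaceD(3)[OF V True] by (auto simp: S_def)
          then show "- p (\<lambda>x. - f x) \<le> q f"
            using sublinear_on_minus[OF V _ True, of q] by linarith
        qed
      next
        case False
        then have "q f = 0" if "q \<in> C" for q using CS[OF that] by (auto simp: S_def)
        then show ?thesis by (intro bdd_belowI2[of _ 0]) (metis order_refl)
      qed
      have le: "u f \<le> q f" if "q \<in> C" for f q
        unfolding u_def using that by (intro cINF_lower bdd)
      have ge: "a \<le> u f" if "\<And>q. q \<in> C \<Longrightarrow> a \<le> q f" for f a
        unfolding u_def using that False by (intro cINF_greatest) auto
      have "sublinear_on V u"
        unfolding sublinear_on_def
      proof (intro conjI ballI allI impI)
        fix f g assume f: "f \<in> V" and g: "g \<in> V"
        have *: "u (\<lambda>x. f x + g x) \<le> q f + q' g" if qq: "q \<in> C" "q' \<in> C" for q q'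
        proof -
          \<comment> \<open>The smaller of \<open>q\<close> and \<open>q'\<close> lies below both,
            and its subadditivity bounds the infimum by the mixed sum. This is where the chain
            property enters.\<close>
          obtain q'' where q'': "q'' \<in> C" "q'' \<le> q" "q'' \<le> q'"
            using tot[OF qq] qq by auto
          have "u (\<lambda>x. f x + g x) \<le> q'' f + q'' g"
            using le[OF q''(1), of "\<lambda>x. f x + g x"] sublinear_onD(1)[OF Csub[OF q''(1)] f g] by linarith
          also have "\<dots> \<le> q f + q' g"
            using q'' by (intro add_mono) (auto simp: le_fun_def)
          finally show ?thesis .
        qed
        have "u (\<lambda>x. f x + g x) - q f \<le> u g" if "q \<in> C" for q
          using *[OF that] by (intro ge) (simp add: algebra_simps)
        then have "u (\<lambda>x. f x + g x) - u g \<le> u f"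
          by (intro ge) (simp add: algebra_simps)
        then show "u (\<lambda>x. f x + g x) \<le> u f + u g" by simp
      next
        fix f :: "'a \<Rightarrow> real" and c :: real assume f: "f \<in> V" and c: "0 \<le> c"
        have *: "u (\<lambda>x. c * f x) \<le> c * q f" if "q \<in> C" for q
          using le[OF that, of "\<lambda>x. c * f x"] sublinear_onD(2)[OF Csub[OF that] f c] by linarith
        show "u (\<lambda>x. c * f x) \<le> c * u f"
        proof (cases "c = 0")
          case True
          then show ?thesis using * False by auto
        next
          case False
          then have "u (\<lambda>x. c * f x) / c \<le> u f"
            using c * by (intro ge) (simp add: field_simps)
          then show ?thesis using False c by (simp add: field_simps)
        qed
      qed
      moreover obtain q0 where q0: "q0 \<in> C" using False by auto
      have "u f \<le> p f" if "f \<in> V" for f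
        using le[OF q0, of f] Cp[OF q0 that] by linarith
      moreover have "u f = 0" if "f \<notin> V" for f
      proof -
        have "q f = 0" if "q \<in> C" for q using CS[OF that] \<open>f \<notin> V\<close> by (auto simp: S_def)
        then show ?thesis using le[OF q0, of f] ge[of 0 f] q0 by (metis antisym order_refl)
      qed
      ultimately have "u \<in> S" by (simp add: S_def)
      then show ?thesis using le by (auto simp: le_fun_def)
    qed
  qed
  then obtain m where m: "m \<in> S" and min: "\<And>q. q \<in> S \<Longrightarrow> q \<le> m \<Longrightarrow> q = m" by blast
  have mp: "m f \<le> p f" if "f \<in> V" for f using m that by (auto simp: S_def)
  have msub: "sublinear_on V m" using m by (auto simp: S_def)
  have "m (\<lambda>x. f x + g x) = m f + m g" if f: "f \<in> V" and g: "g \<in> V" for f g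
  proof (rule antisym)
    obtain q' where q': "sublinear_on V q'" "\<And>f. f \<in> V \<Longrightarrow> q' f \<le> m f"
      "\<And>f. f \<in> V \<Longrightarrow> q' f \<le> m (\<lambda>x. f x + g x) - m g"
      using sublinear_on_tilt[OF V msub g] by blast
    let ?q = "\<lambda>f. if f \<in> V then q' f else 0"
    have "q' f \<le> p f" if "f \<in> V" for f using q'(2)[OF that] mp[OF that] by linarith
    then have "?q \<in> S" using cut[OF q'(1)] by (auto simp: S_def)
    moreover have "?q \<le> m" using q'(2) m by (auto simp: S_def le_fun_def)
    ultimately have "?q = m" by (rule min)
    \<comment> \<open>Minimality against the tilt by \<open>g\<close> reads
      \<open>m f \<le> m (f + g) - m g\<close>, which is the missing superadditivity.\<close>
    from fun_cong[OF this, of f] show "m f + m g \<le> m (\<lambda>x. f x + g x)"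
      using q'(3)[OF f] f by simp
    show "m (\<lambda>x. f x + g x) \<le> m f + m g" by (rule sublinear_onD(1)[OF msub f g])
  qed
  then show ?thesis using mp by (rule_tac that)
qed

text \<open>Tilting by \<open>u\<close> before taking the additive minorant forces
  \<open>l (- u) \<le> - p u\<close>, which together with \<open>l u \<le> p u\<close> fixes the
  value at \<open>u\<close>. Only additivity is recorded, which is what a finitely additive content
  requires.\<close>

lemma Hahn_Banach_additive:
  assumes V: "fun_subspace V" and p: "sublinear_on V p" and u: "u \<in> V"
  obtains l where "\<And>f. f \<in> V \<Longrightarrow> l f \<le> p f" "\<And>f g. f \<in> V \<Longrightarrow> g \<in> V \<Longrightarrow> l (\<lambda>x. f x + g x) = l f + l g"
    "l u = p u"
proof -
  obtain q where q: "sublinear_on V q" "\<And>f. f \<in> V \<Longrightarrow> q f \<le> p f"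
      "\<And>f. f \<in> V \<Longrightarrow> q f \<le> p (\<lambda>x. f x + u x) - p u"
    using sublinear_on_tilt[OF V p u] by blast
  obtain l where l: "\<And>f. f \<in> V \<Longrightarrow> l f \<le> q f"
      "\<And>f g. f \<in> V \<Longrightarrow> g \<in> V \<Longrightarrow> l (\<lambda>x. f x + g x) = l f + l g"
    using sublinear_on_minorant_additive[OF V q(1)] by blast
  have u': "(\<lambda>x. - u x) \<in> V" by (rule fun_subspaceD(3)[OF V u])
  have z: "(\<lambda>x. 0) \<in> V" using fun_subspaceD(2)[OF V u, of 0] by simp
  have "l (\<lambda>x. 0) = 0" using l(2)[OF z z] by simp
  then have "l u = - l (\<lambda>x. - u x)" using l(2)[OF u u'] by simp
  moreover have "p (\<lambda>x. 0) = 0" using sublinear_on_scale[OF V p u, of 0] by simp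
  then have "l (\<lambda>x. - u x) \<le> - p u" using l(1)[OF u'] q(3)[OF u'] by simp
  ultimately have "l u = p u" using l(1)[OF u] q(2)[OF u] by simp
  then show ?thesis using order_trans[OF l(1) q(2)] l(2) by (rule_tac that)
qed

section \<open>Measures on compact spaces\<close>

lemma space_borel_space [simp]: "space (borel_space T) = topspace T"
  unfolding borel_space_def by (rule space_measure_of) (auto dest: openin_subset)

lemma openin_sets_borel_space: "openin T U \<Longrightarrow> U \<in> sets (borel_space T)"
  unfolding borel_space_def by (subst sets_measure_of) (auto dest: openin_subset)

text \<open>The product \<sigma>-algebra may miss open sets of the product topology, so continuity
  alone does not give measurability. Here \<open>{a < f}\<close> is the countable union of the
  compact sets \<open>{a + 1/(n+1) \<le> f}\<close>, and each of these is covered by finitely many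
  measurable open boxes inside \<open>{a < f}\<close>.\<close>

lemma continuous_map_measurable_PiM:
  assumes fin: "finite C" and comp: "\<And>x. x \<in> C \<Longrightarrow> compact_space (T x)"
    and f: "continuous_map (product_topology T C) euclideanreal f"
  shows "f \<in> borel_measurable (Pi\<^sub>M C (\<lambda>x. borel_space (T x)))"
proof (rule borel_measurableI_greater)
  fix a
  let ?M = "Pi\<^sub>M C (\<lambda>x. borel_space (T x))" and ?Y = "product_topology T C"
  have sp: "space ?M = topspace ?Y" by (simp add: space_PiM)
  have cY: "compact_space ?Y" using comp by (simp add: compact_space_product_topology)
  let ?G = "{x \<in> topspace ?Y. a < f x}"
  have "{x \<in> topspace ?Y. f x \<in> {a<..}} = ?G" by auto
  then have G: "openin ?Y ?G" using openin_continuous_map_preimage[OF f, of "{a<..}"] by simp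
  have "\<exists>E. E \<in> sets ?M \<and> {x \<in> topspace ?Y. a + 1 / real (Suc n) \<le> f x} \<subseteq> E \<and> E \<subseteq> ?G" for n
  proof -
    let ?K = "{x \<in> topspace ?Y. a + 1 / real (Suc n) \<le> f x}"
    define W where "W = {Pi\<^sub>E C U | U. (\<forall>i\<in>C. openin (T i) (U i)) \<and> Pi\<^sub>E C U \<subseteq> ?G}"
    have "{x \<in> topspace ?Y. f x \<in> {a + 1 / real (Suc n)..}} = ?K" by auto
    then have "closedin ?Y ?K"
      using closedin_continuous_map_preimage[OF f, of "{a + 1 / real (Suc n)..}"] by simp
    then have K: "compactin ?Y ?K" using cY closedin_compact_space by blast
    have Ws: "E \<in> sets ?M \<and> openin ?Y E \<and> E \<subseteq> ?G" if "E \<in> W" for E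
      using that fin unfolding W_def
      by (auto intro!: sets_PiM_I_finite openin_sets_borel_space simp: openin_PiE)
    have "?K \<subseteq> \<Union>W"
    proof
      fix x assume x: "x \<in> ?K"
      moreover have "a < a + 1 / real (Suc n)" by simp
      ultimately have "x \<in> ?G" by (blast intro: less_le_trans)
      then obtain U where "\<forall>i\<in>C. openin (T i) (U i)" "x \<in> Pi\<^sub>E C U" "Pi\<^sub>E C U \<subseteq> ?G"
        using G unfolding openin_product_topology_alt by blast
      then show "x \<in> \<Union>W" unfolding W_def by blast
    qed
    then obtain F where F: "finite F" "F \<subseteq> W" "?K \<subseteq> \<Union>F"
      using compactinD[OF K] Ws by meson
    have "\<Union>F \<in> sets ?M" using F(1,2) Ws by (intro sets.finite_Union) auto
    moreover have "\<Union>F \<subseteq> ?G" using F(2) Ws by (meson Union_least subsetD)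
    ultimately
    show ?thesis using F(3) by (intro exI[of _ "\<Union>F"] conjI)
  qed
  then have "\<exists>E. \<forall>n. E n \<in> sets ?M \<and>
      {x \<in> topspace ?Y. a + 1 / real (Suc n) \<le> f x} \<subseteq> E n \<and> E n \<subseteq> ?G"
    by (intro choice allI)
  then obtain E where E: "\<forall>n. E n \<in> sets ?M \<and>
      {x \<in> topspace ?Y. a + 1 / real (Suc n) \<le> f x} \<subseteq> E n \<and> E n \<subseteq> ?G" ..
  have "?G \<subseteq> (\<Union>n. E n)"
  proof
    fix x assume x: "x \<in> ?G"
    then obtain n where "inverse (real (Suc n)) < f x - a" using reals_Archimedean[of "f x - a"] by auto
    then have "x \<in> {x \<in> topspace ?Y. a + 1 / real (Suc n) \<le> f x}" using x by (simp add: inverse_eq_divide)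
    then have "x \<in> E n" using E by blast
    then show "x \<in> (\<Union>n. E n)" by blast
  qed
  moreover have "(\<Union>n. E n) \<subseteq> ?G" using E by (intro UN_least) simp
  ultimately have "?G = (\<Union>n. E n)" by (rule equalityI)
  moreover have "(\<Union>n. E n) \<in> sets ?M" using E by (intro sets.countable_UN) (auto simp: image_subset_iff)
  ultimately show "{x \<in> space ?M. a < f x} \<in> sets ?M" by (simp only: sp)
qed

lemma continuous_map_bounded_on_compact_space:
  assumes "compact_space Y" "continuous_map Y euclideanreal f"
  obtains B where "\<And>x. x \<in> topspace Y \<Longrightarrow> \<bar>f x\<bar> \<le> B"
proof -
  have "compactin euclideanreal (f ` topspace Y)"
    using assms image_compactin compact_space_def by blast
  then have "bounded (f ` topspace Y)" by (simp add: compact_imp_bounded)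
  then show ?thesis using that by (auto simp: bounded_iff)
qed

text \<open>Approximability by closed sets from inside and open sets from outside turns finite
  additivity into countable additivity, by the compact-class argument.\<close>

lemma regular_content_extension:
  fixes m :: "'a set \<Rightarrow> real"
  assumes Y: "compact_space Y"
    and nonneg: "\<And>A. A \<subseteq> topspace Y \<Longrightarrow> 0 \<le> m A"
    and add: "\<And>A B. A \<subseteq> topspace Y \<Longrightarrow> B \<subseteq> topspace Y \<Longrightarrow> A \<inter> B = {} \<Longrightarrow> m (A \<union> B) = m A + m B"
  defines "\<A> \<equiv> {A. A \<subseteq> topspace Y \<and>
     (\<forall>\<epsilon>>0. \<exists>K G. closedin Y K \<and> openin Y G \<and> K \<subseteq> A \<and> A \<subseteq> G \<and> m (G - K) < \<epsilon>)}"
  obtains \<mu> where "space \<mu> = topspace Y" "sets \<mu> = sigma_sets (topspace Y) \<A>"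
    "\<And>A. A \<in> \<A> \<Longrightarrow> emeasure \<mu> A = ennreal (m A)"
proof -
  have mono: "m A \<le> m B" if "A \<subseteq> B" "B \<subseteq> topspace Y" for A B
  proof -
    have "m B = m A + m (B - A)" using add[of A "B - A"] that by (auto simp: Un_absorb1)
    then show ?thesis using nonneg[of "B - A"] that by auto
  qed
  have sub: "m (A \<union> B) \<le> m A + m B" if "A \<subseteq> topspace Y" "B \<subseteq> topspace Y" for A B
  proof -
    have "m (A \<union> B) = m A + m (B - A)" using add[of A "B - A"] that by auto
    then show ?thesis using mono[of "B - A" B] that by auto
  qed
  have m0: "m {} = 0" using add[of "{}" "{}"] by simp
  have \<A>D: "\<exists>K G. closedin Y K \<and> openin Y G \<and> K \<subseteq> A \<and> A \<subseteq> G \<and> m (G - K) < \<epsilon>"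
    if "A \<in> \<A>" "\<epsilon> > 0" for A \<epsilon>
    using that unfolding \<A>_def by blast
  have \<A>s: "A \<subseteq> topspace Y" if "A \<in> \<A>" for A using that unfolding \<A>_def by blast
  have "ring_of_sets (topspace Y) \<A>"
    unfolding ring_of_sets_iff
  proof (intro conjI ballI)
    show "\<A> \<subseteq> Pow (topspace Y)" using \<A>s by blast
    show "{} \<in> \<A>" unfolding \<A>_def using m0 by (auto intro!: exI[of _ "{}"])
    fix A B assume A: "A \<in> \<A>" and B: "B \<in> \<A>"
    show "A \<union> B \<in> \<A>"
      unfolding \<A>_def
    proof (intro CollectI conjI allI impI)
      show "A \<union> B \<subseteq> topspace Y" using A B \<A>s by blast
      fix \<epsilon> :: real assume \<epsilon>: "\<epsilon> > 0"
      obtain K G where K: "closedin Y K" "openin Y G" "K \<subseteq> A" "A \<subseteq> G" "m (G - K) < \<epsilon>/2"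
        using \<A>D[OF A, of "\<epsilon>/2"] \<epsilon> by auto
      obtain L H where L: "closedin Y L" "openin Y H" "L \<subseteq> B" "B \<subseteq> H" "m (H - L) < \<epsilon>/2"
        using \<A>D[OF B, of "\<epsilon>/2"] \<epsilon> by auto
      have s: "G \<subseteq> topspace Y" "H \<subseteq> topspace Y" by (rule openin_subset[OF K(2)], rule openin_subset[OF L(2)])
      have "m ((G \<union> H) - (K \<union> L)) \<le> m ((G - K) \<union> (H - L))" using s by (intro mono) auto
      also have "\<dots> \<le> m (G - K) + m (H - L)" using s by (intro sub) auto
      finally show "\<exists>K G. closedin Y K \<and> openin Y G \<and> K \<subseteq> A \<union> B \<and> A \<union> B \<subseteq> G \<and> m (G - K) < \<epsilon>"
        using K L by (intro exI[of _ "K \<union> L"] exI[of _ "G \<union> H"] conjI closedin_Un openin_Un) auto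
    qed
    show "A - B \<in> \<A>"
      unfolding \<A>_def
    proof (intro CollectI conjI allI impI)
      show "A - B \<subseteq> topspace Y" using A \<A>s by blast
      fix \<epsilon> :: real assume \<epsilon>: "\<epsilon> > 0"
      obtain K G where K: "closedin Y K" "openin Y G" "K \<subseteq> A" "A \<subseteq> G" "m (G - K) < \<epsilon>/2"
        using \<A>D[OF A, of "\<epsilon>/2"] \<epsilon> by auto
      obtain L H where L: "closedin Y L" "openin Y H" "L \<subseteq> B" "B \<subseteq> H" "m (H - L) < \<epsilon>/2"
        using \<A>D[OF B, of "\<epsilon>/2"] \<epsilon> by auto
      have s: "G \<subseteq> topspace Y" "H \<subseteq> topspace Y" by (rule openin_subset[OF K(2)], rule openin_subset[OF L(2)])
      \<comment> \<open>For a difference the approximants of \<open>B\<close> trade places: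
        \<open>K - H\<close> is closed, \<open>G - L\<close> is open, and the gap again lies in
        \<open>(G - K) \<union> (H - L)\<close>.\<close>
      have "m ((G - L) - (K - H)) \<le> m ((G - K) \<union> (H - L))" using s by (intro mono) auto
      also have "\<dots> \<le> m (G - K) + m (H - L)" using s by (intro sub) auto
      finally show "\<exists>K G. closedin Y K \<and> openin Y G \<and> K \<subseteq> A - B \<and> A - B \<subseteq> G \<and> m (G - K) < \<epsilon>"
        using K L by (intro exI[of _ "K - H"] exI[of _ "G - L"] conjI closedin_diff openin_diff) auto
    qed
  qed
  then interpret ring_of_sets "topspace Y" \<A> .
  have "\<exists>\<mu> :: 'a set \<Rightarrow> ennreal. (\<forall>s\<in>\<A>. \<mu> s = ennreal (m s)) \<and>
      measure_space (topspace Y) (sigma_sets (topspace Y) \<A>) \<mu>"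
  proof (rule caratheodory_empty_continuous)
    show "positive \<A> (\<lambda>A. ennreal (m A))" by (simp add: positive_def m0)
    show "additive \<A> (\<lambda>A. ennreal (m A))"
      using add nonneg \<A>s by (auto simp: additive_def ennreal_plus)
    fix A :: "nat \<Rightarrow> 'a set"
    assume A: "range A \<subseteq> \<A>" "decseq A" "(\<Inter>i. A i) = {}"
    have As: "A i \<subseteq> topspace Y" for i using A(1) \<A>s by blast
    have "(\<lambda>i. m (A i)) \<longlonglongrightarrow> 0"
    proof (rule LIMSEQ_I)
      fix \<epsilon> :: real assume \<epsilon>: "\<epsilon> > 0"
      \<comment> \<open>Each \<open>A i\<close> is shrunk to a closed \<open>K i\<close> at a cost
        below \<open>\<epsilon> / 2^(i+1)\<close>. The \<open>K i\<close> have empty intersection,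
        so by compactness finitely many of their complements cover the space.\<close>
      have "\<exists>K. closedin Y K \<and> K \<subseteq> A i \<and> m (A i - K) < \<epsilon> * (1/2) ^ Suc i" for i
      proof -
        have "\<epsilon> * (1/2) ^ Suc i > 0" using \<epsilon> by simp
        moreover have "A i \<in> \<A>" using A(1) by blast
        ultimately obtain K G where K: "closedin Y K" "openin Y G" "K \<subseteq> A i" "A i \<subseteq> G"
            "m (G - K) < \<epsilon> * (1/2) ^ Suc i"
          using \<A>D by meson
        have "m (A i - K) \<le> m (G - K)" using K openin_subset[OF K(2)] by (intro mono) auto
        then show ?thesis using K by (intro exI[of _ K]) auto
      qed
      then have "\<exists>K. \<forall>i. closedin Y (K i) \<and> K i \<subseteq> A i \<and> m (A i - K i) < \<epsilon> * (1/2) ^ Suc i"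
        by (intro choice allI)
      then obtain K where "\<forall>i. closedin Y (K i) \<and> K i \<subseteq> A i \<and> m (A i - K i) < \<epsilon> * (1/2) ^ Suc i" ..
      then have K: "\<And>i. closedin Y (K i)" "\<And>i. K i \<subseteq> A i"
          "\<And>i. m (A i - K i) < \<epsilon> * (1/2) ^ Suc i" by simp_all
      define U where "U = range (\<lambda>i. topspace Y - K i)"
      have "topspace Y \<subseteq> \<Union>U"
      proof
        fix x assume "x \<in> topspace Y"
        moreover obtain i where "x \<notin> A i" using A(3) by blast
        ultimately have "x \<in> topspace Y - K i" using K(2) by blast
        then show "x \<in> \<Union>U" unfolding U_def by blast
      qed
      moreover have "\<forall>u\<in>U. openin Y u" using K(1) by (auto simp: U_def)
      ultimately obtain F where F: "finite F" "F \<subseteq> U" "topspace Y \<subseteq> \<Union>F"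
        using Y unfolding compact_space_alt by meson
      then obtain I where I: "finite I" "F = (\<lambda>i. topspace Y - K i) ` I"
        unfolding U_def by (meson finite_subset_image)
      obtain N where N: "I \<subseteq> {..<N}" using I(1) finite_nat_iff_bounded by blast
      \<comment> \<open>The geometric costs add up to a number strictly below \<epsilon> for every
        \<open>n\<close>, which gives the strict final estimate.\<close>
      have bound: "m (\<Union>i<n. A i - K i) \<le> \<epsilon> * (1 - (1/2) ^ n)" for n
      proof (induction n)
        case 0
        then show ?case by (simp add: m0)
      next
        case (Suc n)
        have "(\<Union>i<Suc n. A i - K i) = (\<Union>i<n. A i - K i) \<union> (A n - K n)"
          by (auto simp: less_Suc_eq)
        also have "m \<dots> \<le> m (\<Union>i<n. A i - K i) + m (A n - K n)"
          using As by (intro sub) blast+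
        finally show ?case using Suc K(3)[of n] by (simp add: algebra_simps)
      qed
      show "\<exists>no. \<forall>n\<ge>no. norm (m (A n) - 0) < \<epsilon>"
      proof (intro exI allI impI)
        fix n assume n: "n \<ge> N"
        \<comment> \<open>Every point of \<open>A n\<close> is missed by some \<open>K i\<close>
          with \<open>i < N\<close>, and lies in that \<open>A i\<close> because the sequence
          decreases.\<close>
        have "A n \<subseteq> (\<Union>i<N. A i - K i)"
        proof
          fix x assume x: "x \<in> A n"
          then have "x \<in> \<Union>F" using F(3) As by blast
          then obtain i where i: "i \<in> I" "x \<notin> K i" unfolding I(2) by blast
          have iN: "i < N" using i(1) N by blast
          then have "A n \<subseteq> A i" using n by (intro decseqD[OF A(2)]) simp
          then have "x \<in> A i" using x by (rule subsetD)
          then show "x \<in> (\<Union>i<N. A i - K i)" using iN i(2) by blast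
        qed
        then have "m (A n) \<le> m (\<Union>i<N. A i - K i)" using As by (intro mono) blast+
        also have "\<dots> \<le> \<epsilon> * (1 - (1/2) ^ N)" by (rule bound)
        also have "\<dots> < \<epsilon>" using \<epsilon> by (simp add: algebra_simps)
        finally show "norm (m (A n) - 0) < \<epsilon>" using nonneg[OF As[of n]] by simp
      qed
    qed
    then show "(\<lambda>i. ennreal (m (A i))) \<longlonglongrightarrow> 0" using tendsto_ennrealI by fastforce
  qed auto
  then obtain \<mu> where \<mu>: "\<And>A. A \<in> \<A> \<Longrightarrow> \<mu> A = ennreal (m A)"
      "measure_space (topspace Y) (sigma_sets (topspace Y) \<A>) \<mu>" by blast
  have sb: "\<A> \<subseteq> Pow (topspace Y)" using \<A>s by blast
  show ?thesis
  proof
    let ?N = "measure_of (topspace Y) \<A> \<mu>"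
    show "space ?N = topspace Y" using sb by (rule space_measure_of)
    show "sets ?N = sigma_sets (topspace Y) \<A>" using sb by (rule sets_measure_of)
    show "emeasure ?N A = ennreal (m A)" if "A \<in> \<A>" for A
      using that \<mu> sb emeasure_measure_of_sigma
      by (subst emeasure_measure_of[OF refl]) (auto simp: measure_space_def)
  qed
qed

text \<open>For equal \<sigma>-algebras the setwise order is the one of \<open>le_measure\<close>,
  and nonnegative integrals respect it. Integrability over \<open>M\<close> makes the larger
  integral finite, so the order survives the passage to reals.\<close>

lemma integral_mono_setwise:
  fixes f :: "'a \<Rightarrow> real"
  assumes sets: "sets N = sets M" and le: "\<And>A. A \<in> sets M \<Longrightarrow> emeasure N A \<le> emeasure M A"
    and f: "integrable M f" "\<And>x. x \<in> space M \<Longrightarrow> 0 \<le> f x"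
  shows "(\<integral>x. f x \<partial>N) \<le> (\<integral>x. f x \<partial>M)"
proof -
  have sp: "space N = space M" using sets by (rule sets_eq_imp_space_eq)
  have fN: "f \<in> borel_measurable N" using f(1) measurable_cong_sets[OF sets refl] by auto
  have "N \<le> M" using le le_measure[OF sets] sets by (simp add: le_fun_def)
  then have "(\<integral>\<^sup>+x. f x \<partial>N) \<le> (\<integral>\<^sup>+x. f x \<partial>M)" using sets by (intro nn_integral_mono_measure)
  moreover have "(\<integral>\<^sup>+x. f x \<partial>M) < \<infinity>"
    using nn_integral_eq_integral[OF f(1)] f(2) by simp
  ultimately have "enn2real (\<integral>\<^sup>+x. f x \<partial>N) \<le> enn2real (\<integral>\<^sup>+x. f x \<partial>M)"
    by (intro enn2real_mono) auto
  moreover have "AE x in N. 0 \<le> f x" "AE x in M. 0 \<le> f x" using f(2) sp by (auto intro!: AE_I2)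
  ultimately show ?thesis
    using integral_eq_nn_integral[OF fN] integral_eq_nn_integral[of f M] f(1) by simp
qed

lemma continuous_map_restrict_product_topology:
  assumes "C \<subseteq> X"
  shows "continuous_map (product_topology T X) (product_topology T C) (\<lambda>\<omega>. restrict \<omega> C)"
  unfolding continuous_map_componentwise
proof (intro conjI ballI)
  show "(\<lambda>\<omega>. restrict \<omega> C) ` topspace (product_topology T X) \<subseteq> extensional C" by auto
  fix k assume "k \<in> C"
  then show "continuous_map (product_topology T X) (T k) (\<lambda>\<omega>. restrict \<omega> C k)"
    using assms by (auto intro: continuous_map_product_projection)
qed

text \<open>Compact sets are closed in a Hausdorff space, so regularity approximates
  \<open>A\<close> from inside by closed sets; applied to the complement it approximates
  \<open>A\<close> from outside by open sets. Each side costs \<open>\<epsilon>/2\<close>.\<close>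

lemma regular_measure_approx:
  assumes fm: "finite_measure N" and sp: "space N = topspace Y" and Haus: "Hausdorff_space Y"
    and reg: "regular_measure Y N" and A: "A \<in> sets N" and \<epsilon>: "\<epsilon> > 0"
  obtains K G where "K \<in> sets N" "G \<in> sets N" "closedin Y K" "openin Y G" "K \<subseteq> A" "A \<subseteq> G"
    "measure N (G - K) < \<epsilon>"
proof -
  interpret finite_measure N by (rule fm)
  have inner: "\<exists>K\<in>sets N. closedin Y K \<and> K \<subseteq> A \<and> measure N A - \<delta> < measure N K"
    if A: "A \<in> sets N" and \<delta>: "\<delta> > 0" for A \<delta>
  proof (rule ccontr)
    assume "\<not> ?thesis"
    then have *: "measure N K \<le> measure N A - \<delta>" if "K \<in> sets N" "K \<subseteq> A" "compactin Y K" for K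
      using that compactin_imp_closedin[OF Haus] by (meson not_less)
    have "emeasure N A = (SUP K\<in>{K\<in>sets N. K \<subseteq> A \<and> compactin Y K}. emeasure N K)"
      using reg A unfolding regular_measure_def by blast
    also have "\<dots> \<le> ennreal (measure N A - \<delta>)"
      using * by (intro SUP_least) (auto simp: emeasure_eq_measure intro!: ennreal_leI)
    finally have "ennreal (measure N A) \<le> ennreal (measure N A - \<delta>)" by (simp add: emeasure_eq_measure)
    \<comment> \<open>\<open>ennreal\<close> truncates negative numbers to zero, so nonnegativity,
      read off from the empty set, is established before returning to reals.\<close>
    moreover have "0 \<le> measure N A - \<delta>" using *[of "{}"] by simp
    ultimately have "measure N A \<le> measure N A - \<delta>" using ennreal_le_iff by blast
    then show False using \<delta> by simp
  qed
  obtain K where K: "K \<in> sets N" "closedin Y K" "K \<subseteq> A" "measure N A - \<epsilon>/2 < measure N K"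
    using inner[OF A, of "\<epsilon>/2"] \<epsilon> by auto
  have A': "space N - A \<in> sets N" using A by auto
  obtain L where L: "L \<in> sets N" "closedin Y L" "L \<subseteq> space N - A"
      "measure N (space N - A) - \<epsilon>/2 < measure N L"
    using inner[OF A', of "\<epsilon>/2"] \<epsilon> by auto
  have AG: "A \<subseteq> space N - L" using L(3) sets.sets_into_space[OF A] by blast
  have "measure N ((space N - L) - K) = measure N (space N - L) - measure N K"
    using K L AG by (intro finite_measure_Diff) auto
  also have "\<dots> < \<epsilon>"
    using K(4) L(4) finite_measure_compl[OF A] finite_measure_compl[OF L(1)] by simp
  finally have "measure N ((space N - L) - K) < \<epsilon>" .
  moreover have "space N - L \<in> sets N" using L(1) by auto
  moreover have "openin Y (space N - L)" using L(2) sp by (simp add: openin_diff)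
  ultimately show ?thesis using that[of K "space N - L"] K AG by blast
qed

text \<open>The majorant is the maximum of zero and the \<open>g i\<close>; a finite maximum
  preserves continuity and the bound \<open>b\<close>.\<close>

lemma continuous_majorant_finite:
  fixes b :: "'a \<Rightarrow> real"
  assumes "finite F" "\<And>i. i \<in> F \<Longrightarrow> continuous_map Y euclideanreal (g i)"
    "\<And>i x. i \<in> F \<Longrightarrow> x \<in> topspace Y \<Longrightarrow> g i x \<le> b x" "\<And>x. x \<in> topspace Y \<Longrightarrow> 0 \<le> b x"
  shows "\<exists>h. continuous_map Y euclideanreal h \<and> (\<forall>x\<in>topspace Y. 0 \<le> h x \<and> h x \<le> b x) \<and>
    (\<forall>i\<in>F. \<forall>x\<in>topspace Y. g i x \<le> h x)"
  using assms
proof (induction F)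
  case empty
  then show ?case by (intro exI[of _ "\<lambda>_. 0"]) auto
next
  case (insert i F)
  then obtain h where h: "continuous_map Y euclideanreal h"
      "\<And>x. x \<in> topspace Y \<Longrightarrow> 0 \<le> h x \<and> h x \<le> b x"
      "\<And>i x. i \<in> F \<Longrightarrow> x \<in> topspace Y \<Longrightarrow> g i x \<le> h x"
    by auto
  show ?case
  proof (intro exI[of _ "\<lambda>x. max (g i x) (h x)"] conjI ballI)
    show "continuous_map Y euclideanreal (\<lambda>x. max (g i x) (h x))"
      using insert.prems(1) h(1) by (intro continuous_map_real_max) auto
    show "g j x \<le> max (g i x) (h x)" if "j \<in> insert i F" "x \<in> topspace Y" for j x
      using that h(3) by (auto intro: max.coboundedI2)
  qed (use insert.prems h in \<open>auto intro: max.coboundedI2\<close>)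
qed

section \<open>Violations are bounded by the contextual fraction\<close>

text \<open>\<open>nonempty\<close> sets aside the scenario without contexts, in which nothing
  bounds the mass of a dominated measure.\<close>

locale compact_empirical_model =
  fixes X :: "'x set" and \<M> :: "'x set set" and T :: "'x \<Rightarrow> 'o topology"
    and e :: "'x set \<Rightarrow> ('x \<Rightarrow> 'o) measure"
  assumes cover: "\<Union>\<M> = X" and finite_labels: "finite X" and nonempty: "\<M> \<noteq> {}"
    and compact: "\<And>x. x \<in> X \<Longrightarrow> compact_space (T x)"
    and Hausdorff: "\<And>x. x \<in> X \<Longrightarrow> Hausdorff_space (T x)"
    and model: "empirical_model \<M> (\<lambda>x. borel_space (T x)) e"
begin

section \<open>Outcome spaces, marginals and integrals of forms\<close>

abbreviation \<Omega> where "\<Omega> \<equiv> \<lambda>x. borel_space (T x)"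
abbreviation Y where "Y C \<equiv> product_topology T C"

lemma context_subset: "C \<in> \<M> \<Longrightarrow> C \<subseteq> X" using cover by blast
lemma finite_context: "C \<in> \<M> \<Longrightarrow> finite C" using context_subset finite_labels finite_subset by blast
lemma finite_contexts: "finite \<M>" using cover finite_labels finite_UnionD by blast

lemma space_outcomes: "space (Pi\<^sub>M C \<Omega>) = topspace (Y C)"
  by (simp add: space_PiM)

lemma compact_outcomes: "C \<subseteq> X \<Longrightarrow> compact_space (Y C)"
  using compact by (auto simp: compact_space_product_topology)

lemma Hausdorff_outcomes: "C \<subseteq> X \<Longrightarrow> Hausdorff_space (Y C)"
  using Hausdorff by (auto simp: Hausdorff_space_product_topology)

lemma prob_e: "C \<in> \<M> \<Longrightarrow> prob_space (e C)"
  and sets_e: "C \<in> \<M> \<Longrightarrow> sets (e C) = sets (Pi\<^sub>M C \<Omega>)"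
  using model by (auto simp: empirical_model_def)

lemma space_e: "C \<in> \<M> \<Longrightarrow> space (e C) = topspace (Y C)"
  using sets_eq_imp_space_eq[OF sets_e] space_outcomes by metis

lemma restrict_outcome: "C \<subseteq> D \<Longrightarrow> \<omega> \<in> topspace (Y D) \<Longrightarrow> restrict \<omega> C \<in> topspace (Y C)"
  by auto

lemma measurable_restrict_outcome:
  assumes "sets \<mu> = sets (Pi\<^sub>M D \<Omega>)" "C \<subseteq> D"
  shows "(\<lambda>\<omega>. restrict \<omega> C) \<in> measurable \<mu> (Pi\<^sub>M C \<Omega>)"
  using measurable_restrict_subset[OF assms(2)] measurable_cong_sets[OF assms(1) refl] by blast

lemma sets_marginal [simp]: "sets (marginal \<Omega> C \<mu>) = sets (Pi\<^sub>M C \<Omega>)"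
  by (simp add: marginal_def)

lemma marginal_marginal:
  assumes "sets \<mu> = sets (Pi\<^sub>M D \<Omega>)" "C \<subseteq> D" "B \<subseteq> C"
  shows "marginal \<Omega> B (marginal \<Omega> C \<mu>) = marginal \<Omega> B \<mu>"
  unfolding marginal_def
  using assms by (subst distr_distr[OF measurable_restrict_subset measurable_restrict_outcome])
    (auto simp: comp_def Int_absorb1 intro!: distr_cong)

lemma integral_marginal:
  fixes f :: "_ \<Rightarrow> real"
  assumes "sets \<mu> = sets (Pi\<^sub>M X \<Omega>)" "C \<subseteq> X" "f \<in> borel_measurable (Pi\<^sub>M C \<Omega>)"
  shows "(\<integral>\<omega>. f \<omega> \<partial>marginal \<Omega> C \<mu>) = (\<integral>\<omega>. f (restrict \<omega> C) \<partial>\<mu>)"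
  unfolding marginal_def using assms by (intro integral_distr measurable_restrict_outcome)

lemma finite_marginal:
  assumes "finite_measure \<mu>" "sets \<mu> = sets (Pi\<^sub>M X \<Omega>)" "C \<subseteq> X"
  shows "finite_measure (marginal \<Omega> C \<mu>)"
  unfolding marginal_def using assms by (intro finite_measure.finite_measure_distr measurable_restrict_outcome)

lemma measure_marginal_space:
  assumes "sets \<mu> = sets (Pi\<^sub>M X \<Omega>)" "C \<subseteq> X"
  shows "emeasure (marginal \<Omega> C \<mu>) (topspace (Y C)) = emeasure \<mu> (space \<mu>)"
proof -
  have "(\<lambda>\<omega>. restrict \<omega> C) -` space (Pi\<^sub>M C \<Omega>) \<inter> space \<mu> = space \<mu>"
    using measurable_space[OF measurable_restrict_outcome[OF assms]] by auto
  then show ?thesis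
    unfolding marginal_def space_outcomes[symmetric]
    by (subst emeasure_distr[OF measurable_restrict_outcome[OF assms]]) auto
qed

lemma measurable_form:
  assumes "form T \<M> \<beta>" "C \<in> \<M>"
  shows "\<beta> C \<in> borel_measurable (Pi\<^sub>M C \<Omega>)"
proof (rule continuous_map_measurable_PiM)
  show "compact_space (T x)" if "x \<in> C" for x
    using that context_subset[OF assms(2)] by (intro compact) auto
qed (use assms finite_context in \<open>auto simp: form_def\<close>)

lemma integrable_form:
  assumes "form T \<M> \<beta>" "C \<in> \<M>" "finite_measure N" "sets N = sets (Pi\<^sub>M C \<Omega>)"
  shows "integrable N (\<beta> C)"
proof -
  have cont: "continuous_map (Y C) euclideanreal (\<beta> C)" using assms by (auto simp: form_def)
  obtain B where B: "\<And>x. x \<in> topspace (Y C) \<Longrightarrow> \<bar>\<beta> C x\<bar> \<le> B"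
    using continuous_map_bounded_on_compact_space[OF compact_outcomes[OF context_subset[OF assms(2)]] cont]
    by blast
  have "space N = topspace (Y C)" using sets_eq_imp_space_eq[OF assms(4)] space_outcomes by simp
  moreover have "\<beta> C \<in> borel_measurable N"
    using measurable_form[OF assms(1,2)] measurable_cong_sets[OF assms(4) refl] by blast
  ultimately show ?thesis
    using B by (intro finite_measure.integrable_const_bound[OF assms(3), of _ B]) auto
qed

lemma form_le_Sup:
  assumes "form T \<M> \<beta>" "C \<in> \<M>" "\<omega> \<in> topspace (Y C)"
  shows "\<beta> C \<omega> \<le> (SUP \<omega>\<in>topspace (Y C). \<beta> C \<omega>)"
proof -
  have cont: "continuous_map (Y C) euclideanreal (\<beta> C)" using assms by (auto simp: form_def)
  obtain B where "\<And>x. x \<in> topspace (Y C) \<Longrightarrow> \<bar>\<beta> C x\<bar> \<le> B"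
    using continuous_map_bounded_on_compact_space[OF compact_outcomes[OF context_subset[OF assms(2)]] cont]
    by blast
  then have "bdd_above (\<beta> C ` topspace (Y C))" by (intro bdd_aboveI2[of _ _ B]) (auto simp: abs_le_iff)
  then show ?thesis using assms(3) by (intro cSUP_upper)
qed

text \<open>Divided by its mass, \<open>\<mu>\<close> induces a noncontextual model to which the
  inequality applies, and the value of a form scales linearly with the measure. For mass zero both
  sides vanish.\<close>

lemma bell_inequality_marginals:
  assumes bell: "generalised_bell_inequality X \<M> T \<beta> R"
    and fm: "finite_measure \<mu>" and sets: "sets \<mu> = sets (Pi\<^sub>M X \<Omega>)"
  shows "form_value \<M> \<beta> (\<lambda>C. marginal \<Omega> C \<mu>) \<le> measure \<mu> (space \<mu>) * R"
proof -
  interpret finite_measure \<mu> by (rule fm)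
  let ?w = "measure \<mu> (space \<mu>)"
  have form: "form T \<M> \<beta>" using bell by (simp add: generalised_bell_inequality_def)
  have meas: "(\<lambda>\<omega>. \<beta> C (restrict \<omega> C)) \<in> borel_measurable \<mu>" if "C \<in> \<M>" for C
    by (rule measurable_compose[OF measurable_restrict_outcome[OF sets context_subset[OF that]]
      measurable_form[OF form that]])
  show ?thesis
  proof (cases "?w = 0")
    case True
    then have "AE \<omega> in \<mu>. False"
      by (intro AE_I[of _ _ "space \<mu>"]) (auto simp: emeasure_eq_measure)
    then have "(\<integral>\<omega>. \<beta> C (restrict \<omega> C) \<partial>\<mu>) = 0" if "C \<in> \<M>" for C
      using meas[OF that] by (intro integral_eq_zero_AE) auto
    then have "form_value \<M> \<beta> (\<lambda>C. marginal \<Omega> C \<mu>) = 0"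
      unfolding form_value_def
      by (intro sum.neutral) (simp add: integral_marginal[OF sets context_subset measurable_form[OF form]])
    then show ?thesis using True by simp
  next
    case False
    then have w: "?w > 0" by (simp add: zero_less_measure_iff)
    define \<nu> where "\<nu> = density \<mu> (\<lambda>_. ennreal (1 / ?w))"
    have sets': "sets \<nu> = sets (Pi\<^sub>M X \<Omega>)" by (simp add: \<nu>_def sets)
    have "emeasure \<nu> (space \<nu>) = ennreal (1 / ?w) * emeasure \<mu> (space \<mu>)"
      unfolding \<nu>_def by (subst emeasure_density) (auto simp: nn_integral_cmult_indicator)
    also have "\<dots> = 1"
      using w by (simp add: emeasure_eq_measure ennreal_mult[symmetric])
    finally have prob: "prob_space \<nu>" by (rule prob_spaceI)
    let ?d = "\<lambda>C. marginal \<Omega> C \<nu>"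
    have "empirical_model \<M> \<Omega> ?d"
      unfolding empirical_model_def
    proof (intro conjI ballI)
      fix C assume C: "C \<in> \<M>"
      show "prob_space (?d C)"
        unfolding marginal_def
        by (rule prob_space.prob_space_distr[OF prob
          measurable_restrict_outcome[OF sets' context_subset[OF C]]])
      fix C' assume C': "C' \<in> \<M>"
      show "marginal \<Omega> (C \<inter> C') (?d C) = marginal \<Omega> (C \<inter> C') (?d C')"
        using marginal_marginal[OF sets' context_subset[OF C], of "C \<inter> C'"]
          marginal_marginal[OF sets' context_subset[OF C'], of "C \<inter> C'"] by simp
    qed simp
    moreover have "noncontextual X \<M> \<Omega> ?d"
      using prob sets' by (auto simp: noncontextual_def)
    ultimately have "form_value \<M> \<beta> ?d \<le> R" using bell by (simp add: generalised_bell_inequality_def)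
    moreover have "form_value \<M> \<beta> (\<lambda>C. marginal \<Omega> C \<mu>) = ?w * form_value \<M> \<beta> ?d"
      unfolding form_value_def sum_distrib_left
    proof (rule sum.cong[OF refl])
      fix C assume C: "C \<in> \<M>"
      note im = integral_marginal[OF _ context_subset[OF C] measurable_form[OF form C]]
      have "(\<integral>\<omega>. \<beta> C \<omega> \<partial>?d C) = (\<integral>\<omega>. (1 / ?w) * \<beta> C (restrict \<omega> C) \<partial>\<mu>)"
        unfolding im[OF sets'] using meas[OF C] unfolding \<nu>_def
        by (subst integral_density) auto
      then show "(\<integral>\<omega>. \<beta> C \<omega> \<partial>marginal \<Omega> C \<mu>) = ?w * (\<integral>\<omega>. \<beta> C \<omega> \<partial>?d C)"
        using w by (simp add: im[OF sets])
    qed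
    ultimately show ?thesis using w by (simp add: mult_left_mono)
  qed
qed

text \<open>Every marginal has the mass of \<open>\<mu>\<close>, so comparison with the probability
  measure \<open>e C\<close> of a single context is enough.\<close>

lemma dominated_finite:
  assumes "\<mu> \<in> dominated_measures X \<M> \<Omega> e"
  shows "finite_measure \<mu>" "measure \<mu> (space \<mu>) \<le> 1"
proof -
  have sets: "sets \<mu> = sets (Pi\<^sub>M X \<Omega>)" using assms by (simp add: dominated_measures_def)
  obtain C where C: "C \<in> \<M>" using nonempty by blast
  interpret e: prob_space "e C" by (rule prob_e[OF C])
  have "topspace (Y C) \<in> sets (Pi\<^sub>M C \<Omega>)" using sets.top[of "Pi\<^sub>M C \<Omega>"] space_outcomes by simp
  then have "emeasure (marginal \<Omega> C \<mu>) (topspace (Y C)) \<le> emeasure (e C) (topspace (Y C))"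
    using assms C by (simp add: dominated_measures_def)
  then have "emeasure \<mu> (space \<mu>) \<le> 1"
    using measure_marginal_space[OF sets context_subset[OF C]] e.emeasure_space_1 space_e[OF C] by simp
  then show fm: "finite_measure \<mu>" by (intro finite_measureI) (auto simp: top_unique)
  then show "measure \<mu> (space \<mu>) \<le> 1"
    using \<open>emeasure \<mu> (space \<mu>) \<le> 1\<close> by (simp add: finite_measure.emeasure_eq_measure)
qed

text \<open>The part of \<open>e C\<close> left over by the marginal has mass \<open>1 - w\<close>
  and contributes at most \<open>(1 - w) * S C\<close>, where \<open>S C\<close> is the supremum of
  the form on \<open>C\<close>. The marginals themselves obey the Bell bound scaled by
  \<open>w\<close>.\<close>

lemma form_value_le_dominated:
  assumes bell: "generalised_bell_inequality X \<M> T \<beta> R"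
    and dom: "\<mu> \<in> dominated_measures X \<M> \<Omega> e"
  defines "w \<equiv> measure \<mu> (space \<mu>)"
  shows "form_value \<M> \<beta> e \<le> w * R + (1 - w) * form_norm T \<M> \<beta>"
proof -
  have form: "form T \<M> \<beta>" using bell by (simp add: generalised_bell_inequality_def)
  have sets: "sets \<mu> = sets (Pi\<^sub>M X \<Omega>)" using dom by (simp add: dominated_measures_def)
  note fm = dominated_finite(1)[OF dom]
  define S where "S C = (SUP \<omega>\<in>topspace (Y C). \<beta> C \<omega>)" for C
  have "(\<integral>\<omega>. \<beta> C \<omega> \<partial>e C) \<le> (\<integral>\<omega>. \<beta> C \<omega> \<partial>marginal \<Omega> C \<mu>) + (1 - w) * S C" if C: "C \<in> \<M>" for C
  proof -
    interpret e: prob_space "e C" by (rule prob_e[OF C])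
    interpret N: finite_measure "marginal \<Omega> C \<mu>"
      by (rule finite_marginal[OF fm sets context_subset[OF C]])
    note ie = integrable_form[OF form C e.finite_measure_axioms sets_e[OF C]]
    note iN = integrable_form[OF form C N.finite_measure_axioms sets_marginal]
    \<comment> \<open>Domination compares integrals of nonnegative functions only, hence
      \<open>S C - \<beta> C\<close> in place of \<open>\<beta> C\<close>.\<close>
    have "(\<integral>\<omega>. S C - \<beta> C \<omega> \<partial>marginal \<Omega> C \<mu>) \<le> (\<integral>\<omega>. S C - \<beta> C \<omega> \<partial>e C)"
    proof (rule integral_mono_setwise)
      show "sets (marginal \<Omega> C \<mu>) = sets (e C)" using sets_e[OF C] by simp
      show "emeasure (marginal \<Omega> C \<mu>) A \<le> emeasure (e C) A" if "A \<in> sets (e C)" for A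
        using that dom C sets_e[OF C] by (simp add: dominated_measures_def)
      show "0 \<le> S C - \<beta> C \<omega>" if "\<omega> \<in> space (e C)" for \<omega>
        using that form_le_Sup[OF form C] space_e[OF C] by (simp add: S_def)
    qed (use ie in auto)
    moreover have "space (marginal \<Omega> C \<mu>) = topspace (Y C)"
      by (simp add: marginal_def space_outcomes)
    then have "measure (marginal \<Omega> C \<mu>) (space (marginal \<Omega> C \<mu>)) = w"
      using measure_marginal_space[OF sets context_subset[OF C]] by (simp add: measure_def w_def)
    ultimately show ?thesis
      using ie iN e.prob_space by (simp add: algebra_simps)
  qed
  then have "form_value \<M> \<beta> e \<le> form_value \<M> \<beta> (\<lambda>C. marginal \<Omega> C \<mu>) + (1 - w) * form_norm T \<M> \<beta>"
    unfolding form_value_def form_norm_def S_def sum_distrib_left sum.distrib[symmetric] by (rule sum_mono)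
  then show ?thesis using bell_inequality_marginals[OF bell fm sets] by (simp add: w_def)
qed

text \<open>Every dominated measure of mass \<open>w\<close> bounds the violation by
  \<open>1 - w\<close>; the supremum over \<open>w\<close> turns this into the contextual
  fraction.\<close>

lemma normalised_violation_le_contextual_fraction:
  assumes bell: "generalised_bell_inequality X \<M> T \<beta> R"
  shows "ereal (normalised_violation T \<M> \<beta> R e) \<le> contextual_fraction X \<M> \<Omega> e"
proof -
  let ?v = "normalised_violation T \<M> \<beta> R e"
  have R: "form_norm T \<M> \<beta> - R > 0" using bell by (simp add: generalised_bell_inequality_def)
  have le: "?v \<le> 1 - measure \<mu> (space \<mu>)" if "\<mu> \<in> dominated_measures X \<M> \<Omega> e" for \<mu>
  proof -
    have "form_value \<M> \<beta> e - R \<le> (1 - measure \<mu> (space \<mu>)) * (form_norm T \<M> \<beta> - R)"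
      using form_value_le_dominated[OF bell that] by (simp add: algebra_simps)
    moreover have "0 \<le> (1 - measure \<mu> (space \<mu>)) * (form_norm T \<M> \<beta> - R)"
      using dominated_finite(2)[OF that] R by simp
    ultimately show ?thesis using R by (simp add: normalised_violation_def pos_divide_le_eq)
  qed
  \<comment> \<open>The zero measure is dominated, which yields \<open>?v \<le> 1\<close>, so that
    \<open>ennreal (1 - ?v)\<close> is not truncated.\<close>
  have "null_measure (Pi\<^sub>M X \<Omega>) \<in> dominated_measures X \<M> \<Omega> e"
  proof -
    have "emeasure (marginal \<Omega> C (null_measure (Pi\<^sub>M X \<Omega>))) A = 0"
      if "C \<in> \<M>" "A \<in> sets (Pi\<^sub>M C \<Omega>)" for C A
      unfolding marginal_def
      by (subst emeasure_distr[OF measurable_restrict_outcome[OF _ context_subset]]) (use that in auto)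
    then show ?thesis by (simp add: dominated_measures_def)
  qed
  from le[OF this] have "?v \<le> 1" by simp
  have "noncontextual_fraction X \<M> \<Omega> e \<le> ennreal (1 - ?v)"
    unfolding noncontextual_fraction_def
  proof (rule SUP_least)
    fix \<mu> assume "\<mu> \<in> dominated_measures X \<M> \<Omega> e"
    then show "emeasure \<mu> (space \<mu>) \<le> ennreal (1 - ?v)"
      using le[of \<mu>] dominated_finite(1)[of \<mu>]
      by (simp add: finite_measure.emeasure_eq_measure ennreal_leI)
  qed
  then have "enn2ereal (noncontextual_fraction X \<M> \<Omega> e) \<le> ereal (1 - ?v)"
    using \<open>?v \<le> 1\<close> by (metis enn2ereal_ennreal diff_ge_0_iff_ge less_eq_ennreal.rep_eq)
  then have "ereal 1 - ereal (1 - ?v) \<le> 1 - enn2ereal (noncontextual_fraction X \<M> \<Omega> e)"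
    by (intro ereal_minus_mono) auto
  then show ?thesis by (simp add: contextual_fraction_def)
qed

section \<open>Duality\<close>

text \<open>Bounded nonnegative lower semicontinuous functions, with semicontinuity expressed by
  continuous minorants. Covers by continuous functions would not do in \<open>cover_cost\<close>: a continuous
  majorant of the indicator of a dense open set is at least \<open>1\<close> everywhere, whatever the measure
  of that set.\<close>

definition lsc :: "'x set \<Rightarrow> (('x \<Rightarrow> 'o) \<Rightarrow> real) \<Rightarrow> bool" where
  "lsc C b \<longleftrightarrow> b \<in> borel_measurable (Pi\<^sub>M C \<Omega>) \<and> (\<exists>B. \<forall>y\<in>topspace (Y C). b y \<le> B) \<and>
     (\<forall>y\<in>topspace (Y C). 0 \<le> b y) \<and>
     (\<forall>y\<in>topspace (Y C). \<forall>\<delta>>0. \<exists>h. continuous_map (Y C) euclideanreal h \<and>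
        (\<forall>z\<in>topspace (Y C). h z \<le> b z) \<and> b y - \<delta> < h y)"

lemma lsc_const: "0 \<le> c \<Longrightarrow> lsc C (\<lambda>_. c)"
  unfolding lsc_def by (intro conjI ballI allI impI exI[of _ c] exI[of _ "\<lambda>_. c"]) auto

lemma lsc_add:
  assumes "lsc C b" "lsc C b'"
  shows "lsc C (\<lambda>y. b y + b' y)"
  unfolding lsc_def
proof (intro conjI ballI allI impI)
  show "(\<lambda>y. b y + b' y) \<in> borel_measurable (Pi\<^sub>M C \<Omega>)"
    using assms by (auto simp: lsc_def)
  obtain B B' where "\<forall>y\<in>topspace (Y C). b y \<le> B" "\<forall>y\<in>topspace (Y C). b' y \<le> B'"
    using assms unfolding lsc_def by blast
  then show "\<exists>B. \<forall>y\<in>topspace (Y C). b y + b' y \<le> B"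
    by (intro exI[of _ "B + B'"]) (auto intro: add_mono)
  fix y assume y: "y \<in> topspace (Y C)"
  show "0 \<le> b y + b' y" using assms y by (auto simp: lsc_def)
  fix \<delta> :: real assume "\<delta> > 0"
  then have "\<delta>/2 > 0" by simp
  obtain h where h: "continuous_map (Y C) euclideanreal h" "\<forall>z\<in>topspace (Y C). h z \<le> b z" "b y - \<delta>/2 < h y"
    using assms(1) y \<open>\<delta>/2 > 0\<close> unfolding lsc_def by meson
  obtain h' where h': "continuous_map (Y C) euclideanreal h'" "\<forall>z\<in>topspace (Y C). h' z \<le> b' z" "b' y - \<delta>/2 < h' y"
    using assms(2) y \<open>\<delta>/2 > 0\<close> unfolding lsc_def by meson
  show "\<exists>h. continuous_map (Y C) euclideanreal h \<and> (\<forall>z\<in>topspace (Y C). h z \<le> b z + b' z) \<and>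
      b y + b' y - \<delta> < h y"
    using h h' by (intro exI[of _ "\<lambda>y. h y + h' y"]) (auto intro!: add_mono continuous_map_add)
qed

lemma lsc_scale:
  assumes "lsc C b" "0 \<le> c"
  shows "lsc C (\<lambda>y. c * b y)"
proof (cases "c = 0")
  case True
  then show ?thesis using lsc_const[of 0 C] by simp
next
  case False
  then have c: "c > 0" using assms by simp
  show ?thesis
    unfolding lsc_def
  proof (intro conjI ballI allI impI)
    show "(\<lambda>y. c * b y) \<in> borel_measurable (Pi\<^sub>M C \<Omega>)"
      using assms by (auto simp: lsc_def)
    obtain B where "\<forall>y\<in>topspace (Y C). b y \<le> B" using assms unfolding lsc_def by blast
    then show "\<exists>B. \<forall>y\<in>topspace (Y C). c * b y \<le> B"
      using c by (intro exI[of _ "c * B"]) auto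
    fix y assume y: "y \<in> topspace (Y C)"
    show "0 \<le> c * b y" using assms y by (auto simp: lsc_def)
    fix \<delta> :: real assume "\<delta> > 0"
    then have "\<delta>/c > 0" using c by simp
    then obtain h where h: "continuous_map (Y C) euclideanreal h" "\<forall>z\<in>topspace (Y C). h z \<le> b z"
        "b y - \<delta>/c < h y"
      using assms(1) y unfolding lsc_def by meson
    have "c * (b y - \<delta>/c) < c * h y" using h(3) c by (rule mult_strict_left_mono)
    then show "\<exists>h. continuous_map (Y C) euclideanreal h \<and> (\<forall>z\<in>topspace (Y C). h z \<le> c * b z) \<and>
        c * b y - \<delta> < h y"
      using h c by (intro exI[of _ "\<lambda>y. c * h y"]) (auto simp: right_diff_distrib intro: continuous_map_real_mult_left)
  qed
qed

text \<open>Compact Hausdorff spaces are completely regular: for a point of \<open>G\<close> some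
  continuous \<open>f\<close> vanishes there and equals \<open>1\<close> off \<open>G\<close>, so
  \<open>1 - f\<close> is a minorant with the exact value at that point. Off \<open>G\<close> the
  zero function serves.\<close>

lemma lsc_indicator:
  assumes "C \<subseteq> X" "openin (Y C) G" "G \<in> sets (Pi\<^sub>M C \<Omega>)"
  shows "lsc C (indicator G)"
  unfolding lsc_def
proof (intro conjI ballI allI impI)
  show "(indicator G :: _ \<Rightarrow> real) \<in> borel_measurable (Pi\<^sub>M C \<Omega>)"
    using assms by simp
  show "\<exists>B. \<forall>y\<in>topspace (Y C). (indicator G y :: real) \<le> B"
    by (intro exI[of _ 1]) (auto simp: indicator_def)
  fix y assume y: "y \<in> topspace (Y C)"
  show "0 \<le> (indicator G y :: real)" by simp
  fix \<delta> :: real assume \<delta>: "\<delta> > 0"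
  show "\<exists>h. continuous_map (Y C) euclideanreal h \<and> (\<forall>z\<in>topspace (Y C). h z \<le> indicator G z) \<and>
      indicator G y - \<delta> < h y"
  proof (cases "y \<in> G")
    case False
    then show ?thesis using \<delta> by (intro exI[of _ "\<lambda>_. 0"]) auto
  next
    case True
    have "completely_regular_space (Y C)"
      using compact_outcomes[OF assms(1)] Hausdorff_outcomes[OF assms(1)]
      by (intro normal_imp_completely_regular_space compact_Hausdorff_or_regular_imp_normal_space) auto
    moreover have "closedin (Y C) (topspace (Y C) - G)" using assms(2) by blast
    moreover have "y \<in> topspace (Y C) - (topspace (Y C) - G)" using y True by blast
    ultimately obtain f :: "('x \<Rightarrow> 'o) \<Rightarrow> real" where f: "continuous_map (Y C) (top_of_set {0..1}) f" "f y = 0"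
        "f ` (topspace (Y C) - G) \<subseteq> {1}"
      unfolding completely_regular_space_def by metis
    have f': "continuous_map (Y C) euclideanreal f" "\<And>z. z \<in> topspace (Y C) \<Longrightarrow> 0 \<le> f z"
      using f(1) by (auto simp: continuous_map_in_subtopology)
    show ?thesis
    proof (intro exI[of _ "\<lambda>y. 1 - f y"] conjI ballI)
      show "continuous_map (Y C) euclideanreal (\<lambda>y. 1 - f y)"
        using f'(1) by (intro continuous_map_diff) auto
      show "1 - f z \<le> indicator G z" if "z \<in> topspace (Y C)" for z
      proof (cases "z \<in> G")
        case True
        then show ?thesis using f'(2)[OF that] by simp
      next
        case False
        then have "f z = 1" using that f(3) by blast
        then show ?thesis by simp
      qed
      show "indicator G y - \<delta> < 1 - f y" using True f(2) \<delta> by simp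
    qed
  qed
qed

lemma integrable_lsc:
  assumes "C \<in> \<M>" "lsc C b"
  shows "integrable (e C) b"
proof -
  interpret prob_space "e C" by (rule prob_e[OF assms(1)])
  obtain B where "\<forall>y\<in>topspace (Y C). b y \<le> B" "\<forall>y\<in>topspace (Y C). 0 \<le> b y"
    using assms(2) unfolding lsc_def by blast
  moreover have "b \<in> borel_measurable (e C)"
    using assms(2) measurable_cong_sets[OF sets_e[OF assms(1)] refl] unfolding lsc_def by blast
  ultimately show ?thesis
    using space_e[OF assms(1)] by (intro integrable_const_bound[of _ B] AE_I2) auto
qed

section \<open>The cover cost as a sublinear functional\<close>

definition covering :: "(('x \<Rightarrow> 'o) \<Rightarrow> real) \<Rightarrow> ('x set \<Rightarrow> ('x \<Rightarrow> 'o) \<Rightarrow> real) \<Rightarrow> bool" where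
  "covering f b \<longleftrightarrow> (\<forall>C\<in>\<M>. lsc C (b C)) \<and>
     (\<forall>\<omega>\<in>topspace (Y X). f \<omega> \<le> (\<Sum>C\<in>\<M>. b C (restrict \<omega> C)))"

text \<open>For \<open>f = 1\<close> this is the value of a linear program dual to the one behind
  \<open>noncontextual_fraction\<close>: measures on the global outcomes are traded for functions on
  the contexts.\<close>

definition cover_cost :: "(('x \<Rightarrow> 'o) \<Rightarrow> real) \<Rightarrow> real" where
  "cover_cost f = (INF b\<in>Collect (covering f). form_value \<M> b e)"

definition bounded_functions :: "(('x \<Rightarrow> 'o) \<Rightarrow> real) set" where
  "bounded_functions = {f. \<exists>B. \<forall>\<omega>\<in>topspace (Y X). \<bar>f \<omega>\<bar> \<le> B}"

lemma fun_subspace_bounded_functions: "fun_subspace bounded_functions"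
  unfolding fun_subspace_def bounded_functions_def
proof (intro conjI ballI allI)
  fix f g :: "('x \<Rightarrow> 'o) \<Rightarrow> real"
  assume "f \<in> {f. \<exists>B. \<forall>\<omega>\<in>topspace (Y X). \<bar>f \<omega>\<bar> \<le> B}" "g \<in> {f. \<exists>B. \<forall>\<omega>\<in>topspace (Y X). \<bar>f \<omega>\<bar> \<le> B}"
  then obtain B B' where "\<forall>\<omega>\<in>topspace (Y X). \<bar>f \<omega>\<bar> \<le> B" "\<forall>\<omega>\<in>topspace (Y X). \<bar>g \<omega>\<bar> \<le> B'" by blast
  then have "\<forall>\<omega>\<in>topspace (Y X). \<bar>f \<omega> + g \<omega>\<bar> \<le> B + B'" by (meson abs_triangle_ineq add_mono order_trans)
  then show "(\<lambda>x. f x + g x) \<in> {f. \<exists>B. \<forall>\<omega>\<in>topspace (Y X). \<bar>f \<omega>\<bar> \<le> B}" by blast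
next
  fix f :: "('x \<Rightarrow> 'o) \<Rightarrow> real" and c :: real
  assume "f \<in> {f. \<exists>B. \<forall>\<omega>\<in>topspace (Y X). \<bar>f \<omega>\<bar> \<le> B}"
  then obtain B where "\<forall>\<omega>\<in>topspace (Y X). \<bar>f \<omega>\<bar> \<le> B" by blast
  then have "\<forall>\<omega>\<in>topspace (Y X). \<bar>c * f \<omega>\<bar> \<le> \<bar>c\<bar> * B" by (simp add: abs_mult mult_left_mono)
  then show "(\<lambda>x. c * f x) \<in> {f. \<exists>B. \<forall>\<omega>\<in>topspace (Y X). \<bar>f \<omega>\<bar> \<le> B}" by blast
qed

lemma form_value_covering_nonneg:
  assumes "covering f b"
  shows "0 \<le> form_value \<M> b e"
  unfolding form_value_def
proof (rule sum_nonneg)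
  fix C assume C: "C \<in> \<M>"
  then have "\<And>y. y \<in> topspace (Y C) \<Longrightarrow> 0 \<le> b C y" using assms by (auto simp: covering_def lsc_def)
  then show "0 \<le> (\<integral>y. b C y \<partial>e C)" using space_e[OF C] by (intro integral_nonneg_AE AE_I2) auto
qed

lemma cover_cost_le: "covering f b \<Longrightarrow> cover_cost f \<le> form_value \<M> b e"
  unfolding cover_cost_def
  by (intro cINF_lower bdd_belowI2[of _ 0]) (auto intro: form_value_covering_nonneg)

text \<open>This keeps the infimum in \<open>cover_cost\<close> from ranging over the empty set. One
  context with the constant \<open>max 0 B\<close> already reaches \<open>f\<close>, and the others
  add nonnegative amounts.\<close>

lemma ex_covering:
  assumes "f \<in> bounded_functions"
  shows "\<exists>b. covering f b"
proof -
  obtain B where B: "\<forall>\<omega>\<in>topspace (Y X). \<bar>f \<omega>\<bar> \<le> B" using assms by (auto simp: bounded_functions_def)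
  obtain C where C: "C \<in> \<M>" using nonempty by blast
  have "f \<omega> \<le> (\<Sum>C\<in>\<M>. max 0 B)" if "\<omega> \<in> topspace (Y X)" for \<omega>
  proof -
    have "f \<omega> \<le> max 0 B" using B that by (force simp: abs_le_iff)
    also have "\<dots> \<le> (\<Sum>C\<in>\<M>. max 0 B)"
      using member_le_sum[OF C, of "\<lambda>_. max 0 B"] finite_contexts by simp
    finally show ?thesis .
  qed
  then have "covering f (\<lambda>_ _. max 0 B)" by (simp add: covering_def lsc_const)
  then show ?thesis by blast
qed

lemma cover_cost_less:
  assumes "f \<in> bounded_functions" "cover_cost f < r"
  shows "\<exists>b. covering f b \<and> form_value \<M> b e < r"
  using assms ex_covering[OF assms(1)] unfolding cover_cost_def
  by (subst (asm) cINF_less_iff) (auto intro: form_value_covering_nonneg bdd_belowI2[of _ 0])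

lemma cover_cost_ge:
  assumes "f \<in> bounded_functions" "\<And>b. covering f b \<Longrightarrow> r \<le> form_value \<M> b e"
  shows "r \<le> cover_cost f"
  using cover_cost_less[OF assms(1), of r] assms(2) by force

lemma form_value_add:
  assumes "covering f b" "covering g b'"
  shows "form_value \<M> (\<lambda>C y. b C y + b' C y) e = form_value \<M> b e + form_value \<M> b' e"
  unfolding form_value_def sum.distrib[symmetric]
  using assms by (intro sum.cong refl Bochner_Integration.integral_add integrable_lsc) (auto simp: covering_def)

lemma sublinear_on_cover_cost: "sublinear_on bounded_functions cover_cost"
  unfolding sublinear_on_def
proof (intro conjI ballI allI impI)
  fix f g assume f: "f \<in> bounded_functions" and g: "g \<in> bounded_functions"
  have *: "cover_cost (\<lambda>x. f x + g x) \<le> form_value \<M> b e + form_value \<M> b' e"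
    if "covering f b" "covering g b'" for b b'
  proof -
    have "covering (\<lambda>x. f x + g x) (\<lambda>C y. b C y + b' C y)"
      using that by (auto simp: covering_def sum.distrib intro!: lsc_add add_mono)
    from cover_cost_le[OF this] show ?thesis using form_value_add[OF that] by simp
  qed
  have "cover_cost (\<lambda>x. f x + g x) - form_value \<M> b e \<le> cover_cost g" if "covering f b" for b
    using *[OF that] by (intro cover_cost_ge[OF g]) (simp add: algebra_simps)
  then have "cover_cost (\<lambda>x. f x + g x) - cover_cost g \<le> cover_cost f"
    by (intro cover_cost_ge[OF f]) (simp add: algebra_simps)
  then show "cover_cost (\<lambda>x. f x + g x) \<le> cover_cost f + cover_cost g" by simp
next
  fix f :: "('x \<Rightarrow> 'o) \<Rightarrow> real" and c :: real
  assume f: "f \<in> bounded_functions" and c: "0 \<le> c"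
  have *: "cover_cost (\<lambda>x. c * f x) \<le> c * form_value \<M> b e" if "covering f b" for b
  proof -
    have "covering (\<lambda>x. c * f x) (\<lambda>C y. c * b C y)"
      using that c by (auto simp: covering_def sum_distrib_left[symmetric] intro!: lsc_scale mult_left_mono)
    from cover_cost_le[OF this] show ?thesis by (simp add: form_value_def sum_distrib_left)
  qed
  show "cover_cost (\<lambda>x. c * f x) \<le> c * cover_cost f"
  proof (cases "c = 0")
    case True
    then show ?thesis using * ex_covering[OF f] by auto
  next
    case False
    then have "cover_cost (\<lambda>x. c * f x) / c \<le> cover_cost f"
      using c * by (intro cover_cost_ge[OF f]) (simp add: field_simps)
    then show ?thesis using False c by (simp add: field_simps)
  qed
qed

lemma cover_cost_nonneg: "f \<in> bounded_functions \<Longrightarrow> 0 \<le> cover_cost f"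
  by (rule cover_cost_ge) (auto intro: form_value_covering_nonneg)

text \<open>Through this bound an additive functional below \<open>cover_cost\<close> is nonpositive
  on nonpositive functions, hence monotone.\<close>

lemma cover_cost_nonpos:
  assumes "\<And>\<omega>. \<omega> \<in> topspace (Y X) \<Longrightarrow> f \<omega> \<le> 0"
  shows "cover_cost f \<le> 0"
proof -
  have "covering f (\<lambda>_ _. 0)" using assms by (simp add: covering_def lsc_const)
  from cover_cost_le[OF this] show ?thesis by (simp add: form_value_def)
qed

section \<open>From the cover cost to a dominated measure\<close>

lemma indicator_bounded: "indicator A \<in> bounded_functions"
  unfolding bounded_functions_def by (intro CollectI exI[of _ 1]) (auto simp: indicator_def)

abbreviation preimage where
  "preimage C A \<equiv> {\<omega> \<in> topspace (Y X). restrict \<omega> C \<in> A}"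

text \<open>The covering with the indicator of \<open>G\<close> at \<open>C\<close> and zero at the
  other contexts costs exactly the measure of \<open>G\<close>; openness of \<open>G\<close> makes
  it lower semicontinuous.\<close>

lemma cover_cost_open_preimage:
  assumes C: "C \<in> \<M>" and G: "openin (Y C) G" "G \<in> sets (Pi\<^sub>M C \<Omega>)"
  shows "cover_cost (indicator (preimage C G)) \<le> measure (e C) G"
proof -
  let ?b = "\<lambda>D. if D = C then indicator G else (\<lambda>_. 0 :: real)"
  have lsc: "lsc D (?b D)" if "D \<in> \<M>" for D
    using that lsc_indicator[OF context_subset[OF C] G] lsc_const[of 0 D] by auto
  have "indicator (preimage C G) \<omega> \<le> (\<Sum>D\<in>\<M>. ?b D (restrict \<omega> D))" for \<omega>
  proof -
    have "(\<Sum>D\<in>\<M>. ?b D (restrict \<omega> D)) = (\<Sum>D\<in>\<M>. if D = C then indicator G (restrict \<omega> C) else 0)"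
      by (intro sum.cong) auto
    also have "\<dots> = indicator G (restrict \<omega> C)"
      using C finite_contexts by simp
    finally show ?thesis by (simp add: indicator_def)
  qed
  then have "covering (indicator (preimage C G)) ?b" using lsc by (simp add: covering_def)
  then have "cover_cost (indicator (preimage C G)) \<le> form_value \<M> ?b e" by (rule cover_cost_le)
  moreover have "form_value \<M> ?b e = (\<Sum>D\<in>\<M>. if D = C then measure (e C) G else 0)"
    unfolding form_value_def using G sets_e[OF C] by (intro sum.cong) auto
  then have "form_value \<M> ?b e = measure (e C) G" using C finite_contexts by simp
  ultimately show ?thesis by simp
qed

text \<open>This is the strong half of the duality: the value of the covering problem is the mass of
  a dominated measure. Regularity supplies both the passage from open to measurable sets and the
  countable additivity.\<close>

lemma dominated_measure_of_cover_cost: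
  assumes reg: "\<And>C. C \<in> \<M> \<Longrightarrow> regular_measure (Y C) (e C)"
  obtains \<mu> where "\<mu> \<in> dominated_measures X \<M> \<Omega> e"
    "emeasure \<mu> (space \<mu>) = ennreal (cover_cost (\<lambda>_. 1))"
proof -
  let ?S = "topspace (Y X)"
  let ?ind = "\<lambda>A. indicator A :: ('x \<Rightarrow> 'o) \<Rightarrow> real"
  have one: "(\<lambda>_. 1) \<in> bounded_functions" unfolding bounded_functions_def by (intro CollectI exI[of _ 1]) auto
  obtain l where l: "\<And>f. f \<in> bounded_functions \<Longrightarrow> l f \<le> cover_cost f"
      "\<And>f g. f \<in> bounded_functions \<Longrightarrow> g \<in> bounded_functions \<Longrightarrow> l (\<lambda>x. f x + g x) = l f + l g"
      "l (\<lambda>_. 1) = cover_cost (\<lambda>_. 1)"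
    using Hahn_Banach_additive[OF fun_subspace_bounded_functions sublinear_on_cover_cost one] by blast
  have zero: "(\<lambda>_. 0) \<in> bounded_functions" unfolding bounded_functions_def by auto
  have l0: "l (\<lambda>_. 0) = 0" using l(2)[OF zero zero] by simp
  \<comment> \<open>The function \<open>f - g\<close> is nonpositive on the outcome space, so its
    cover cost, and with it the value of \<open>l\<close>, is at most zero.\<close>
  have lmono: "l f \<le> l g" if f: "f \<in> bounded_functions" and g: "g \<in> bounded_functions"
    and le: "\<And>\<omega>. \<omega> \<in> ?S \<Longrightarrow> f \<omega> \<le> g \<omega>" for f g
  proof -
    have f': "(\<lambda>x. - g x) \<in> bounded_functions"
      by (rule fun_subspaceD(3)[OF fun_subspace_bounded_functions g])
    have fg: "(\<lambda>x. f x + - g x) \<in> bounded_functions"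
      by (rule fun_subspaceD(1)[OF fun_subspace_bounded_functions f f'])
    have "l (\<lambda>x. f x + - g x) \<le> 0"
      using l(1)[OF fg] cover_cost_nonpos[of "\<lambda>x. f x + - g x"] le by (force intro: order_trans)
    moreover have "l (\<lambda>x. g x + (f x + - g x)) = l g + l (\<lambda>x. f x + - g x)"
      by (rule l(2)[OF g fg])
    ultimately show ?thesis by simp
  qed
  define m where "m A = l (?ind A)" for A
  have nonneg: "0 \<le> m A" for A
    using lmono[OF zero indicator_bounded] l0 by (simp add: m_def)
  have add: "m (A \<union> B) = m A + m B" if "A \<inter> B = {}" for A B
  proof -
    have "?ind (A \<union> B) = (\<lambda>x. ?ind A x + ?ind B x)"
      using that by (auto simp: fun_eq_iff indicator_def)
    then show ?thesis unfolding m_def using l(2)[OF indicator_bounded indicator_bounded] by simp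
  qed
  have mmono: "m A \<le> m B" if "A \<subseteq> B" for A B
    unfolding m_def using that by (intro lmono indicator_bounded) (auto simp: indicator_def)
  have m_open: "m (preimage C G) \<le> measure (e C) G"
    if "C \<in> \<M>" "openin (Y C) G" "G \<in> sets (Pi\<^sub>M C \<Omega>)" for C G
    unfolding m_def using l(1)[OF indicator_bounded] cover_cost_open_preimage[OF that] by (rule order_trans)
  have approx: "\<exists>K G. K \<in> sets (e C) \<and> G \<in> sets (e C) \<and> closedin (Y C) K \<and> openin (Y C) G \<and>
      K \<subseteq> A \<and> A \<subseteq> G \<and> measure (e C) (G - K) < \<epsilon>"
    if C: "C \<in> \<M>" and A: "A \<in> sets (e C)" and \<epsilon>: "\<epsilon> > 0" for C A and \<epsilon> :: real
  proof -
    interpret prob_space "e C" by (rule prob_e[OF C])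
    show ?thesis
      using regular_measure_approx[OF finite_measure_axioms space_e[OF C]
        Hausdorff_outcomes[OF context_subset[OF C]] reg[OF C] A \<epsilon>] by metis
  qed
  \<comment> \<open>The bound for open sets passes to a measurable \<open>A\<close> through an open
    \<open>G\<close> above it whose measure exceeds that of \<open>A\<close> by less than
    \<epsilon>.\<close>
  have m_le: "m (preimage C A) \<le> measure (e C) A" if C: "C \<in> \<M>" and A: "A \<in> sets (e C)" for C A
  proof (rule field_le_epsilon)
    fix \<epsilon> :: real assume \<epsilon>: "\<epsilon> > 0"
    interpret prob_space "e C" by (rule prob_e[OF C])
    obtain K G where KG: "K \<in> sets (e C)" "G \<in> sets (e C)" "openin (Y C) G"
        "K \<subseteq> A" "A \<subseteq> G" "measure (e C) (G - K) < \<epsilon>"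
      using approx[OF C A \<epsilon>] by blast
    have "m (preimage C A) \<le> m (preimage C G)" using KG by (intro mmono) auto
    also have "\<dots> \<le> measure (e C) G" using KG sets_e[OF C] by (intro m_open C) auto
    also have "\<dots> = measure (e C) (G - K) + measure (e C) K"
      using KG by (subst finite_measure_Diff) auto
    also have "\<dots> \<le> \<epsilon> + measure (e C) A"
      using KG A by (intro add_mono finite_measure_mono) auto
    finally show "m (preimage C A) \<le> measure (e C) A + \<epsilon>" by simp
  qed
  \<comment> \<open>This repeats the class of \<open>regular_content_extension\<close> for
    \<open>Y X\<close>, so that \<open>folded\<close> can name it.\<close>
  define \<A> where "\<A> = {A. A \<subseteq> ?S \<and>
     (\<forall>\<epsilon>>0. \<exists>K G. closedin (Y X) K \<and> openin (Y X) G \<and> K \<subseteq> A \<and> A \<subseteq> G \<and> m (G - K) < \<epsilon>)}"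
  obtain \<mu>0 where \<mu>0: "space \<mu>0 = ?S" "sets \<mu>0 = sigma_sets ?S \<A>"
      "\<And>A. A \<in> \<A> \<Longrightarrow> emeasure \<mu>0 A = ennreal (m A)"
    by (rule regular_content_extension[of "Y X" m,
          OF compact_outcomes[OF order_refl] nonneg add, folded \<A>_def]) (assumption, rule that)
  \<comment> \<open>The closed and open approximants of \<open>A\<close> pull back along the
    continuous restriction map, and \<open>m_le\<close> bounds the content of the pulled back gap by
    its measure.\<close>
  have pre: "preimage C A \<in> \<A>" if C: "C \<in> \<M>" and A: "A \<in> sets (e C)" for C A
    unfolding \<A>_def
  proof (intro CollectI conjI allI impI)
    fix \<epsilon> :: real assume \<epsilon>: "\<epsilon> > 0"
    obtain K G where KG: "K \<in> sets (e C)" "G \<in> sets (e C)" "closedin (Y C) K" "openin (Y C) G"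
        "K \<subseteq> A" "A \<subseteq> G" "measure (e C) (G - K) < \<epsilon>"
      using approx[OF C A \<epsilon>] by blast
    have cont: "continuous_map (Y X) (Y C) (\<lambda>\<omega>. restrict \<omega> C)"
      by (rule continuous_map_restrict_product_topology[OF context_subset[OF C]])
    have "preimage C G - preimage C K = preimage C (G - K)" by auto
    moreover have "m (preimage C (G - K)) \<le> measure (e C) (G - K)" using KG by (intro m_le C) auto
    ultimately show "\<exists>K G. closedin (Y X) K \<and> openin (Y X) G \<and> K \<subseteq> preimage C A \<and> preimage C A \<subseteq> G \<and>
        m (G - K) < \<epsilon>"
      using KG openin_continuous_map_preimage[OF cont KG(4)] closedin_continuous_map_preimage[OF cont KG(3)]
      by (intro exI[of _ "preimage C K"] exI[of _ "preimage C G"] conjI) auto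
  qed auto
  have \<A>_sets: "A \<in> sets \<mu>0" if "A \<in> \<A>" for A using that \<mu>0(2) by auto
  \<comment> \<open>The \<sigma>-algebra of \<open>\<mu>0\<close> is generated by
    \<open>\<A>\<close> and may exceed the product one; measurability of the identity allows
    \<open>\<mu>0\<close> to be restricted. Each coordinate lies in some context, so its preimages
    are among the cylinders of \<open>pre\<close>.\<close>
  have id: "(\<lambda>\<omega>. \<omega>) \<in> measurable \<mu>0 (Pi\<^sub>M X \<Omega>)"
  proof (rule measurable_PiM_single'[of X "\<lambda>i \<omega>. \<omega> i", simplified])
    fix x assume x: "x \<in> X"
    then obtain C where C: "C \<in> \<M>" "x \<in> C" using cover by blast
    show "(\<lambda>\<omega>. \<omega> x) \<in> measurable \<mu>0 (borel_space (T x))"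
    proof (rule measurableI)
      show "\<omega> x \<in> space (borel_space (T x))" if "\<omega> \<in> space \<mu>0" for \<omega>
        using that x \<mu>0(1) by auto
      fix A assume A: "A \<in> sets (borel_space (T x))"
      have "(\<lambda>\<omega>. \<omega> x) \<in> measurable (Pi\<^sub>M C \<Omega>) (borel_space (T x))"
        using measurable_component_singleton[OF C(2), of \<Omega>] by simp
      then have "(\<lambda>\<omega>. \<omega> x) -` A \<inter> space (Pi\<^sub>M C \<Omega>) \<in> sets (Pi\<^sub>M C \<Omega>)"
        using A by (rule measurable_sets)
      then have "preimage C ((\<lambda>\<omega>. \<omega> x) -` A \<inter> space (Pi\<^sub>M C \<Omega>)) \<in> sets \<mu>0"
        using sets_e[OF C(1)] by (intro \<A>_sets pre C) auto
      also have "preimage C ((\<lambda>\<omega>. \<omega> x) -` A \<inter> space (Pi\<^sub>M C \<Omega>)) = (\<lambda>\<omega>. \<omega> x) -` A \<inter> space \<mu>0"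
        using C(2) restrict_outcome[OF context_subset[OF C(1)]] by (auto simp: \<mu>0(1) space_outcomes)
      finally show "(\<lambda>\<omega>. \<omega> x) -` A \<inter> space \<mu>0 \<in> sets \<mu>0" .
    qed
  qed (use \<mu>0(1) in auto)
  define \<mu> where "\<mu> = distr \<mu>0 (Pi\<^sub>M X \<Omega>) (\<lambda>\<omega>. \<omega>)"
  have sets: "sets \<mu> = sets (Pi\<^sub>M X \<Omega>)" by (simp add: \<mu>_def)
  have em: "emeasure \<mu> A = emeasure \<mu>0 A" if "A \<in> sets (Pi\<^sub>M X \<Omega>)" for A
    using sets.sets_into_space[OF that] unfolding \<mu>_def
    by (subst emeasure_distr[OF id that]) (simp add: \<mu>0(1) space_outcomes Int_absorb2)
  show ?thesis
  proof
    show "\<mu> \<in> dominated_measures X \<M> \<Omega> e"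
      unfolding dominated_measures_def
    proof (intro CollectI conjI ballI sets)
      fix C A assume C: "C \<in> \<M>" and A: "A \<in> sets (Pi\<^sub>M C \<Omega>)"
      interpret prob_space "e C" by (rule prob_e[OF C])
      note mr = measurable_restrict_outcome[OF sets context_subset[OF C]]
      have "space \<mu> = ?S" by (simp add: \<mu>_def space_outcomes)
      then have eq: "(\<lambda>\<omega>. restrict \<omega> C) -` A \<inter> space \<mu> = preimage C A" by auto
      have "emeasure (marginal \<Omega> C \<mu>) A = emeasure \<mu>0 (preimage C A)"
        unfolding marginal_def emeasure_distr[OF mr A] eq
        using measurable_sets[OF mr A] by (intro em) (simp only: eq sets)
      also have "\<dots> = ennreal (m (preimage C A))"
        using A sets_e[OF C] by (intro \<mu>0(3) pre C) auto
      also have "\<dots> \<le> emeasure (e C) A"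
        unfolding emeasure_eq_measure using A sets_e[OF C] by (intro ennreal_leI m_le C) auto
      finally show "emeasure (marginal \<Omega> C \<mu>) A \<le> emeasure (e C) A" .
    qed
    have "?S \<in> \<A>"
      unfolding \<A>_def
    proof (intro CollectI conjI allI impI order_refl)
      fix \<epsilon> :: real assume "\<epsilon> > 0"
      moreover have "m {} = 0" using add[of "{}" "{}"] by simp
      ultimately show "\<exists>K G. closedin (Y X) K \<and> openin (Y X) G \<and> K \<subseteq> ?S \<and> ?S \<subseteq> G \<and> m (G - K) < \<epsilon>"
        using closedin_topspace[of "Y X"] openin_topspace[of "Y X"]
        by (intro exI[of _ ?S] conjI) auto
    qed
    have S: "space \<mu> = ?S" "?S \<in> sets (Pi\<^sub>M X \<Omega>)"
      using sets.top[of "Pi\<^sub>M X \<Omega>"] by (auto simp: \<mu>_def space_outcomes)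
    \<comment> \<open>The indicator of \<open>?S\<close> agrees with the constant \<open>1\<close>
      only on \<open>?S\<close>; monotonicity, which compares functions there alone, equates their
      values under \<open>l\<close>.\<close>
    have "m ?S = l (\<lambda>_. 1)"
      unfolding m_def by (intro antisym lmono indicator_bounded one) auto
    then show "emeasure \<mu> (space \<mu>) = ennreal (cover_cost (\<lambda>_. 1))"
      unfolding S(1) em[OF S(2)] \<mu>0(3)[OF \<open>?S \<in> \<A>\<close>] l(3)[symmetric] by simp
  qed
qed

section \<open>Bell inequalities from continuous covers\<close>

text \<open>Near-optimal continuous minorants at a point \<open>\<omega>\<close> sum to more than
  \<open>1 - \<epsilon>\<close> there, hence on an open neighbourhood of \<open>\<omega>\<close>.
  Finitely many such neighbourhoods cover the compact outcome space, and contextwise maxima of the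
  corresponding minorants work everywhere.\<close>

lemma continuous_covering:
  assumes b: "covering (\<lambda>_. 1) b" and \<epsilon>: "\<epsilon> > 0"
  obtains h where "form T \<M> h" "\<And>C y. C \<in> \<M> \<Longrightarrow> y \<in> topspace (Y C) \<Longrightarrow> 0 \<le> h C y"
    "\<And>C y. C \<in> \<M> \<Longrightarrow> y \<in> topspace (Y C) \<Longrightarrow> h C y \<le> b C y"
    "\<And>\<omega>. \<omega> \<in> topspace (Y X) \<Longrightarrow> 1 - \<epsilon> < (\<Sum>C\<in>\<M>. h C (restrict \<omega> C))"
proof -
  \<comment> \<open>The loss \<epsilon> is shared equally among the contexts.\<close>
  define \<delta> where "\<delta> = \<epsilon> / card \<M>"
  have card: "card \<M> > 0" using nonempty finite_contexts by (simp add: card_gt_0_iff)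
  then have \<delta>: "\<delta> > 0" using \<epsilon> by (simp add: \<delta>_def)
  have b_lsc: "lsc C (b C)" if "C \<in> \<M>" for C using b that by (simp add: covering_def)
  have "\<exists>g. continuous_map (Y C) euclideanreal g \<and> (\<forall>z\<in>topspace (Y C). g z \<le> b C z) \<and>
      b C (restrict \<omega> C) - \<delta> < g (restrict \<omega> C)"
    if \<omega>: "\<omega> \<in> topspace (Y X)" and C: "C \<in> \<M>" for \<omega> C
    using b_lsc[OF C] \<delta> restrict_outcome[OF context_subset[OF C] \<omega>] unfolding lsc_def by meson
  then have "\<forall>p\<in>topspace (Y X) \<times> \<M>. \<exists>g. continuous_map (Y (snd p)) euclideanreal g \<and>
      (\<forall>z\<in>topspace (Y (snd p)). g z \<le> b (snd p) z) \<and>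
      b (snd p) (restrict (fst p) (snd p)) - \<delta> < g (restrict (fst p) (snd p))" by auto
  from bchoice[OF this] obtain g where "\<forall>p\<in>topspace (Y X) \<times> \<M>. continuous_map (Y (snd p)) euclideanreal (g p) \<and>
      (\<forall>z\<in>topspace (Y (snd p)). g p z \<le> b (snd p) z) \<and>
      b (snd p) (restrict (fst p) (snd p)) - \<delta> < g p (restrict (fst p) (snd p))" ..
  then have g: "continuous_map (Y C) euclideanreal (g (\<omega>, C))"
      "\<And>z. z \<in> topspace (Y C) \<Longrightarrow> g (\<omega>, C) z \<le> b C z"
      "b C (restrict \<omega> C) - \<delta> < g (\<omega>, C) (restrict \<omega> C)"
    if "\<omega> \<in> topspace (Y X)" "C \<in> \<M>" for \<omega> C using that by auto
  define s where "s \<omega> \<omega>' = (\<Sum>C\<in>\<M>. g (\<omega>, C) (restrict \<omega>' C))" for \<omega> \<omega>'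
  define W where "W \<omega> = {\<omega>' \<in> topspace (Y X). s \<omega> \<omega>' \<in> {1 - \<epsilon><..}}" for \<omega>
  have "openin (Y X) (W \<omega>)" if \<omega>: "\<omega> \<in> topspace (Y X)" for \<omega>
    unfolding W_def
  proof (rule openin_continuous_map_preimage)
    show "continuous_map (Y X) euclideanreal (s \<omega>)"
      unfolding s_def
    proof (intro continuous_map_sum finite_contexts)
      fix C assume C: "C \<in> \<M>"
      show "continuous_map (Y X) euclideanreal (\<lambda>\<omega>'. g (\<omega>, C) (restrict \<omega>' C))"
        using continuous_map_compose[OF
            continuous_map_restrict_product_topology[OF context_subset[OF C]] g(1)[OF \<omega> C]]
        by (simp add: comp_def)
    qed
  qed simp
  moreover have "\<omega> \<in> W \<omega>" if \<omega>: "\<omega> \<in> topspace (Y X)" for \<omega>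
  proof -
    have "1 \<le> (\<Sum>C\<in>\<M>. b C (restrict \<omega> C))" using b \<omega> by (simp add: covering_def)
    then have "1 - \<epsilon> \<le> (\<Sum>C\<in>\<M>. b C (restrict \<omega> C) - \<delta>)"
      using card by (simp add: sum_subtractf \<delta>_def)
    also have "\<dots> < s \<omega> \<omega>"
      unfolding s_def using g(3)[OF \<omega>] by (intro sum_strict_mono finite_contexts nonempty)
    finally show ?thesis using \<omega> by (simp add: W_def)
  qed
  ultimately have "(\<forall>U\<in>W ` topspace (Y X). openin (Y X) U) \<and> topspace (Y X) \<subseteq> \<Union>(W ` topspace (Y X))"
    by blast
  then obtain \<F> where "finite \<F>" "\<F> \<subseteq> W ` topspace (Y X)" "topspace (Y X) \<subseteq> \<Union>\<F>"
    using compact_outcomes[OF order_refl] unfolding compact_space_alt by meson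
  then obtain F where F: "F \<subseteq> topspace (Y X)" "finite F" "topspace (Y X) \<subseteq> \<Union>(W ` F)"
    by (metis finite_subset_image)
  \<comment> \<open>A single \<open>h C\<close> lies above the minorants of all
    \<open>\<omega>\<close> in \<open>F\<close>, so the sum over contexts exceeds every
    \<open>s \<omega>\<close> at once.\<close>
  have "\<forall>C\<in>\<M>. \<exists>h. continuous_map (Y C) euclideanreal h \<and>
      (\<forall>y\<in>topspace (Y C). 0 \<le> h y \<and> h y \<le> b C y) \<and>
      (\<forall>\<omega>\<in>F. \<forall>y\<in>topspace (Y C). g (\<omega>, C) y \<le> h y)"
  proof
    fix C assume C: "C \<in> \<M>"
    show "\<exists>h. continuous_map (Y C) euclideanreal h \<and>
      (\<forall>y\<in>topspace (Y C). 0 \<le> h y \<and> h y \<le> b C y) \<and>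
      (\<forall>\<omega>\<in>F. \<forall>y\<in>topspace (Y C). g (\<omega>, C) y \<le> h y)"
    proof (rule continuous_majorant_finite[OF F(2)])
      show "0 \<le> b C y" if "y \<in> topspace (Y C)" for y
        using b_lsc[OF C] that by (simp add: lsc_def)
    qed (use g C F(1) in blast)+
  qed
  from bchoice[OF this] obtain h where "\<forall>C\<in>\<M>. continuous_map (Y C) euclideanreal (h C) \<and>
      (\<forall>y\<in>topspace (Y C). 0 \<le> h C y \<and> h C y \<le> b C y) \<and>
      (\<forall>\<omega>\<in>F. \<forall>y\<in>topspace (Y C). g (\<omega>, C) y \<le> h C y)" ..
  then have h: "form T \<M> h" "\<And>C y. C \<in> \<M> \<Longrightarrow> y \<in> topspace (Y C) \<Longrightarrow> 0 \<le> h C y"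
      "\<And>C y. C \<in> \<M> \<Longrightarrow> y \<in> topspace (Y C) \<Longrightarrow> h C y \<le> b C y"
      "\<And>C \<omega> y. C \<in> \<M> \<Longrightarrow> \<omega> \<in> F \<Longrightarrow> y \<in> topspace (Y C) \<Longrightarrow> g (\<omega>, C) y \<le> h C y"
    by (simp_all add: form_def)
  have "1 - \<epsilon> < (\<Sum>C\<in>\<M>. h C (restrict \<omega> C))" if \<omega>: "\<omega> \<in> topspace (Y X)" for \<omega>
  proof -
    obtain \<omega>' where \<omega>': "\<omega>' \<in> F" "\<omega> \<in> W \<omega>'" using F(3) \<omega> by blast
    have "1 - \<epsilon> < s \<omega>' \<omega>" using \<omega>'(2) by (simp add: W_def)
    also have "\<dots> \<le> (\<Sum>C\<in>\<M>. h C (restrict \<omega> C))"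
      unfolding s_def by (intro sum_mono h(4) \<omega>'(1) restrict_outcome[OF context_subset \<omega>])
    finally show ?thesis .
  qed
  then show ?thesis using h(1-3) by (rule_tac that)
qed

text \<open>The pullbacks of the \<open>\<beta> C\<close> sum to \<open>1 - \<epsilon>\<close> minus
  a larger number, so the value on noncontextual models is at most \<open>0\<close>. As
  \<open>h \<ge> 0\<close>, the norm of \<open>\<beta>\<close> is at most \<open>1\<close>, and
  dividing by it does not decrease the value \<open>1 - \<epsilon> - form_value \<M> h e\<close> on
  \<open>e\<close>.\<close>

lemma bell_inequality_of_covering:
  assumes \<epsilon>: "0 < \<epsilon>" "\<epsilon> < 1" and h: "form T \<M> h"
    and nonneg: "\<And>C y. C \<in> \<M> \<Longrightarrow> y \<in> topspace (Y C) \<Longrightarrow> 0 \<le> h C y"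
    and cov: "\<And>\<omega>. \<omega> \<in> topspace (Y X) \<Longrightarrow> 1 - \<epsilon> < (\<Sum>C\<in>\<M>. h C (restrict \<omega> C))"
    and v: "0 < v" "v \<le> 1 - \<epsilon> - form_value \<M> h e"
  shows "\<exists>\<beta>. generalised_bell_inequality X \<M> T \<beta> 0 \<and> v \<le> normalised_violation T \<M> \<beta> 0 e"
proof -
  define c where "c = (1 - \<epsilon>) / card \<M>"
  have card: "card \<M> > 0" using nonempty finite_contexts by (simp add: card_gt_0_iff)
  have csum: "(\<Sum>C\<in>\<M>. c) = 1 - \<epsilon>" using card by (simp add: c_def)
  define \<beta> where "\<beta> = (\<lambda>C y. c - h C y)"
  have form: "form T \<M> \<beta>"
    using h unfolding form_def \<beta>_def by (auto intro!: continuous_map_diff)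
  have integral: "(\<integral>y. \<beta> C y \<partial>N) = c - (\<integral>y. h C y \<partial>N)"
    if "C \<in> \<M>" "prob_space N" "sets N = sets (Pi\<^sub>M C \<Omega>)" for C N
  proof -
    interpret prob_space N by (rule that(2))
    show ?thesis
      using integrable_form[OF h that(1) finite_measure_axioms that(3)] prob_space by (simp add: \<beta>_def)
  qed
  have val: "form_value \<M> \<beta> e = 1 - \<epsilon> - form_value \<M> h e"
    unfolding form_value_def using integral[OF _ prob_e sets_e] csum by (simp add: sum_subtractf)
  have top: "topspace (Y C) \<noteq> {}" if "C \<in> \<M>" for C
    using prob_space.not_empty[OF prob_e[OF that]] space_e[OF that] by simp
  have "form_norm T \<M> \<beta> \<le> (\<Sum>C\<in>\<M>. c)"
    unfolding form_norm_def using top nonneg by (intro sum_mono cSUP_least) (auto simp: \<beta>_def)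
  then have norm: "form_norm T \<M> \<beta> \<le> 1" using csum \<epsilon> by simp
  have "form_value \<M> \<beta> e \<le> form_norm T \<M> \<beta>"
    unfolding form_value_def form_norm_def
  proof (rule sum_mono)
    fix C assume C: "C \<in> \<M>"
    interpret prob_space "e C" by (rule prob_e[OF C])
    show "(\<integral>y. \<beta> C y \<partial>e C) \<le> (SUP y\<in>topspace (Y C). \<beta> C y)"
      using form_le_Sup[OF form C] space_e[OF C]
      by (intro integral_le_const integrable_form[OF form C finite_measure_axioms sets_e[OF C]] AE_I2) auto
  qed
  \<comment> \<open>The bound \<open>0\<close> has to lie strictly below the norm; the norm is at
    least the value on \<open>e\<close>, which is at least \<open>v > 0\<close>.\<close>
  then have pos: "0 < form_norm T \<M> \<beta>" using v val by simp
  have "form_value \<M> \<beta> d \<le> 0" if nc: "noncontextual X \<M> \<Omega> d" for d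
  proof -
    obtain \<mu> where \<mu>: "prob_space \<mu>" "sets \<mu> = sets (Pi\<^sub>M X \<Omega>)" "\<And>C. C \<in> \<M> \<Longrightarrow> marginal \<Omega> C \<mu> = d C"
      using nc by (auto simp: noncontextual_def)
    interpret prob_space \<mu> by (rule \<mu>(1))
    have sp: "space \<mu> = topspace (Y X)" using sets_eq_imp_space_eq[OF \<mu>(2)] space_outcomes by simp
    have int: "integrable \<mu> (\<lambda>\<omega>. \<beta> C (restrict \<omega> C))" if C: "C \<in> \<M>" for C
    proof -
      have "integrable (marginal \<Omega> C \<mu>) (\<beta> C)"
        by (rule integrable_form[OF form C finite_marginal[OF finite_measure_axioms \<mu>(2) context_subset[OF C]] sets_marginal])
      then show ?thesis
        unfolding marginal_def
        by (rule integrable_distr[OF measurable_restrict_outcome[OF \<mu>(2) context_subset[OF C]]])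
    qed
    have "form_value \<M> \<beta> d = (\<Sum>C\<in>\<M>. \<integral>\<omega>. \<beta> C (restrict \<omega> C) \<partial>\<mu>)"
      unfolding form_value_def
      using integral_marginal[OF \<mu>(2) context_subset measurable_form[OF form]] \<mu>(3) by (intro sum.cong) auto
    also have "\<dots> = (\<integral>\<omega>. (\<Sum>C\<in>\<M>. \<beta> C (restrict \<omega> C)) \<partial>\<mu>)"
      by (rule Bochner_Integration.integral_sum[OF int, symmetric])
    also have "\<dots> \<le> 0"
    proof (intro integral_le_const Bochner_Integration.integrable_sum int AE_I2)
      fix \<omega> assume "\<omega> \<in> space \<mu>"
      then show "(\<Sum>C\<in>\<M>. \<beta> C (restrict \<omega> C)) \<le> 0"
        using cov[of \<omega>] sp csum by (simp add: \<beta>_def sum_subtractf)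
    qed
    finally show ?thesis .
  qed
  then have "generalised_bell_inequality X \<M> T \<beta> 0"
    using form pos by (simp add: generalised_bell_inequality_def)
  moreover have "v \<le> form_value \<M> \<beta> e / form_norm T \<M> \<beta>"
  proof -
    have "v * form_norm T \<M> \<beta> \<le> v * 1" using v(1) norm by (intro mult_left_mono) auto
    then have "v * form_norm T \<M> \<beta> \<le> form_value \<M> \<beta> e" using v val by linarith
    then show ?thesis using pos by (simp add: pos_le_divide_eq)
  qed
  then have "v \<le> normalised_violation T \<M> \<beta> 0 e"
    using v val by (simp add: normalised_violation_def)
  ultimately show ?thesis by blast
qed

text \<open>A dominated measure of mass \<open>q\<close> gives the upper bound \<open>1 - q\<close>
  for the contextual fraction, and nearly optimal covers give violations close to
  \<open>1 - q\<close>.\<close>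

lemma ex_bell_inequality_violation:
  assumes reg: "\<And>C. C \<in> \<M> \<Longrightarrow> regular_measure (Y C) (e C)"
    and CF: "contextual_fraction X \<M> \<Omega> e > 0" and \<epsilon>: "\<epsilon> > 0"
  shows "\<exists>\<beta> R. generalised_bell_inequality X \<M> T \<beta> R \<and>
    contextual_fraction X \<M> \<Omega> e - ereal \<epsilon> \<le> ereal (normalised_violation T \<M> \<beta> R e)"
proof -
  define q where "q = cover_cost (\<lambda>_. 1)"
  have one: "(\<lambda>_. 1) \<in> bounded_functions" unfolding bounded_functions_def by (intro CollectI exI[of _ 1]) auto
  have q0: "0 \<le> q" unfolding q_def by (rule cover_cost_nonneg[OF one])
  obtain \<mu> where \<mu>: "\<mu> \<in> dominated_measures X \<M> \<Omega> e" "emeasure \<mu> (space \<mu>) = ennreal q"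
    using dominated_measure_of_cover_cost[OF reg] unfolding q_def by blast
  have "ennreal q \<le> noncontextual_fraction X \<M> \<Omega> e"
    unfolding noncontextual_fraction_def \<mu>(2)[symmetric] by (rule SUP_upper[OF \<mu>(1)])
  then have "ereal q \<le> enn2ereal (noncontextual_fraction X \<M> \<Omega> e)"
    using q0 by (metis enn2ereal_ennreal less_eq_ennreal.rep_eq)
  then have CF_le: "contextual_fraction X \<M> \<Omega> e \<le> ereal (1 - q)"
    unfolding contextual_fraction_def using ereal_minus_mono[of 1 1 "ereal q"] by (simp add: one_ereal_def)
  have "0 < ereal (1 - q)" using CF CF_le by (rule order.strict_trans2)
  then have q1: "q < 1" by simp
  \<comment> \<open>One half of \<open>\<eta>\<close> pays for a nearly optimal cover and the other
    for making it continuous. The second term of the minimum keeps \<open>1 - q - \<eta>\<close>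
    positive, as the construction of the inequality demands.\<close>
  define \<eta> where "\<eta> = min \<epsilon> ((1 - q) / 2)"
  have \<eta>: "0 < \<eta>" "\<eta> \<le> \<epsilon>" "\<eta> < 1 - q" using \<epsilon> q1 by (auto simp: \<eta>_def min_def)
  then have "q < q + \<eta> / 2" by simp
  then obtain b where b: "covering (\<lambda>_. 1) b" "form_value \<M> b e < q + \<eta> / 2"
    using cover_cost_less[OF one] unfolding q_def by blast
  have "\<eta> / 2 > 0" using \<eta> by simp
  then obtain h where h: "form T \<M> h" "\<And>C y. C \<in> \<M> \<Longrightarrow> y \<in> topspace (Y C) \<Longrightarrow> 0 \<le> h C y"
      "\<And>C y. C \<in> \<M> \<Longrightarrow> y \<in> topspace (Y C) \<Longrightarrow> h C y \<le> b C y"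
      "\<And>\<omega>. \<omega> \<in> topspace (Y X) \<Longrightarrow> 1 - \<eta> / 2 < (\<Sum>C\<in>\<M>. h C (restrict \<omega> C))"
    using continuous_covering[OF b(1)] by blast
  have "form_value \<M> h e \<le> form_value \<M> b e"
    unfolding form_value_def
  proof (rule sum_mono)
    fix C assume C: "C \<in> \<M>"
    interpret prob_space "e C" by (rule prob_e[OF C])
    show "(\<integral>y. h C y \<partial>e C) \<le> (\<integral>y. b C y \<partial>e C)"
      using h(3)[OF C] space_e[OF C] b(1) C
      by (intro integral_mono integrable_form[OF h(1) C finite_measure_axioms sets_e[OF C]] integrable_lsc)
        (auto simp: covering_def)
  qed
  then have "1 - q - \<eta> \<le> 1 - \<eta> / 2 - form_value \<M> h e" using b(2) by simp
  moreover have "0 < 1 - q - \<eta>" "\<eta> / 2 < 1" using \<eta> q0 by auto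
  ultimately obtain \<beta> where \<beta>: "generalised_bell_inequality X \<M> T \<beta> 0"
      "1 - q - \<eta> \<le> normalised_violation T \<M> \<beta> 0 e"
    using bell_inequality_of_covering[OF \<open>\<eta> / 2 > 0\<close> _ h(1,2,4)] by blast
  have "contextual_fraction X \<M> \<Omega> e - ereal \<epsilon> \<le> ereal (1 - q) - ereal \<epsilon>"
    using CF_le by (intro ereal_minus_mono) auto
  also have "\<dots> \<le> ereal (normalised_violation T \<M> \<beta> 0 e)" using \<beta>(2) \<eta>(2) by simp
  finally show ?thesis using \<beta>(1) by blast
qed

end

section \<open>The scenario without contexts, and the conclusion\<close>

lemma prob_space_empty_product: "prob_space (return (Pi\<^sub>M {} \<Omega>) (\<lambda>_. undefined))"
  by (rule prob_space_return) (simp add: space_PiM)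

theorem theorem4:
  fixes X :: "'x set"
    and \<M> :: "'x set set"
    and T :: "'x \<Rightarrow> 'o topology"
    and e :: "'x set \<Rightarrow> ('x \<Rightarrow> 'o) measure"
  defines "\<Omega> \<equiv> (\<lambda>x. borel_space (T x))"
  assumes "measurement_scenario X \<M>"
    and "finite X"
    and "\<And>x. x \<in> X \<Longrightarrow> compact_space (T x) \<and> Hausdorff_space (T x)"
    and "empirical_model \<M> \<Omega> e"
  shows "(\<forall>\<beta> R. generalised_bell_inequality X \<M> T \<beta> R \<longrightarrow>
            ereal (normalised_violation T \<M> \<beta> R e) \<le> contextual_fraction X \<M> \<Omega> e) \<and>
         ((\<forall>C\<in>\<M>. regular_measure (product_topology T C) (e C)) \<longrightarrow>
            contextual_fraction X \<M> \<Omega> e > 0 \<longrightarrow>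
            (\<forall>\<epsilon>>0. \<exists>\<beta> R. generalised_bell_inequality X \<M> T \<beta> R \<and>
               ereal (normalised_violation T \<M> \<beta> R e) \<ge> contextual_fraction X \<M> \<Omega> e - ereal \<epsilon>))"
proof (cases "\<M> = {}")
  case True
  then have X: "X = {}" using assms by (auto simp: measurement_scenario_def)
  define \<mu> where "\<mu> = return (Pi\<^sub>M {} \<Omega>) (\<lambda>_. undefined :: 'o)"
  have \<mu>: "prob_space \<mu>" "sets \<mu> = sets (Pi\<^sub>M X \<Omega>)"
    using prob_space_empty_product X by (auto simp: \<mu>_def)
  have "empirical_model \<M> \<Omega> e \<and> noncontextual X \<M> \<Omega> e"
    using \<mu> assms(5) True by (auto simp: noncontextual_def)
  \<comment> \<open>With no contexts every form has value and norm \<open>0\<close>, so a Bell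
    inequality would need both \<open>R < 0\<close> and \<open>0 \<le> R\<close>.\<close>
  then have "\<not> generalised_bell_inequality X \<M> T \<beta> R" for \<beta> R
    using True by (fastforce simp: generalised_bell_inequality_def form_norm_def form_value_def \<Omega>_def)
  \<comment> \<open>A point mass is vacuously dominated, so the noncontextual fraction is at least
    \<open>1\<close>, and the second claim holds vacuously.\<close>
  moreover have "\<not> contextual_fraction X \<M> \<Omega> e > 0"
  proof -
    have "\<mu> \<in> dominated_measures X \<M> \<Omega> e" using \<mu> True by (simp add: dominated_measures_def)
    then have "emeasure \<mu> (space \<mu>) \<le> noncontextual_fraction X \<M> \<Omega> e"
      unfolding noncontextual_fraction_def by (rule SUP_upper)
    then have "1 \<le> noncontextual_fraction X \<M> \<Omega> e" using prob_space.emeasure_space_1[OF \<mu>(1)] by simp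
    then have "1 \<le> enn2ereal (noncontextual_fraction X \<M> \<Omega> e)"
      by (metis less_eq_ennreal.rep_eq one_ennreal.rep_eq)
    then have "contextual_fraction X \<M> \<Omega> e \<le> 1 - 1"
      unfolding contextual_fraction_def by (intro ereal_minus_mono) auto
    then show ?thesis by simp
  qed
  ultimately show ?thesis by blast
next
  case False
  interpret compact_empirical_model X \<M> T e
    using assms False by unfold_locales (auto simp: measurement_scenario_def)
  show ?thesis
    unfolding \<Omega>_def using normalised_violation_le_contextual_fraction ex_bell_inequality_violation by blast
qed

end
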